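(* There is a functor $H$ from the category of 3-dimensional oriented real inner product spaces, with orientation-preserving isometries as morphisms, to the category of real algebras isomorphic to the quaternions $\mathbb{H}$, with algebra isomorphisms as morphisms, sending $V$ to $H(V)=\mathbb{R}\oplus V$ equipped with the product $$(\alpha,\mathbf{a})(\beta,\mathbf{b})=(\alpha\beta-\mathbf{a}\cdot\mathbf{b},\ \alpha\mathbf{b}+\beta\mathbf{a}+\mathbf{a}\times\mathbf{b})\qquad(\alpha,\beta\in\mathbb{R},\ \mathbf{a},\mathbf{b}\in V).$$ This functor $H$ is an equivalence of categories.
   Context: An algebra means a finite-dimensional vector space with a bilinear, not necessarily associative, product and a unit element $1$. $\mathbb{H}$ is the 4-dimensional real algebra of quaternions. For a 3-dimensional oriented real inner product space $V$ with inner product $\cdot\colon V\times V\to\mathbb{R}$, let $\omega\in\Lambda^3V^*$ be the volume form determined by the inner product and orientation (equal to $1$ on every positively oriented orthonormal basis). The cross product $\times\colon V\times V\to V$ is the antisymmetric bilinear map determined by $(\mathbf{a}\times\mathbf{b})\cdot\mathbf{c}=\omega(\mathbf{a},\mathbf{b},\mathbf{c})$ for all $\mathbf{a},\mathbf{b},\mathbf{c}\in V$. Isometries are linear. *)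

theory Defs
  imports "Jordan_Normal_Form.VS_Connect"
begin

section \<open>Categories, functors and equivalences\<close>

text \<open>
  Hom-sets need not be disjoint: an arrow is only meaningful together with its domain and codomain,
  so composition and the arrow part of a functor take the objects as arguments.
\<close>

record ('o, 'm) cat =
  Ob :: "'o set"
  Hom :: "'o \<Rightarrow> 'o \<Rightarrow> 'm set"
  Id :: "'o \<Rightarrow> 'm"
  Comp :: "'o \<Rightarrow> 'o \<Rightarrow> 'o \<Rightarrow> 'm \<Rightarrow> 'm \<Rightarrow> 'm"
    \<comment> \<open>\<open>Comp C X Y Z g f\<close> is \<open>g \<circ> f\<close> for \<open>f : X \<rightarrow> Y\<close> and \<open>g : Y \<rightarrow> Z\<close>\<close>

locale category =
  fixes C :: "('o, 'm) cat"
  assumes Id_in_Hom: "X \<in> Ob C \<Longrightarrow> Id C X \<in> Hom C X X"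
    and Comp_in_Hom:
      "\<lbrakk>X \<in> Ob C; Y \<in> Ob C; Z \<in> Ob C; f \<in> Hom C X Y; g \<in> Hom C Y Z\<rbrakk>
        \<Longrightarrow> Comp C X Y Z g f \<in> Hom C X Z"
    and Comp_Id_right:
      "\<lbrakk>X \<in> Ob C; Y \<in> Ob C; f \<in> Hom C X Y\<rbrakk> \<Longrightarrow> Comp C X X Y f (Id C X) = f"
    and Comp_Id_left:
      "\<lbrakk>X \<in> Ob C; Y \<in> Ob C; f \<in> Hom C X Y\<rbrakk> \<Longrightarrow> Comp C X Y Y (Id C Y) f = f"
    and Comp_assoc:
      "\<lbrakk>W \<in> Ob C; X \<in> Ob C; Y \<in> Ob C; Z \<in> Ob C;
        f \<in> Hom C W X; g \<in> Hom C X Y; h \<in> Hom C Y Z\<rbrakk>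
        \<Longrightarrow> Comp C W X Z (Comp C X Y Z h g) f = Comp C W Y Z h (Comp C W X Y g f)"

record ('o, 'm, 'p, 'n) functor_data =
  on_ob :: "'o \<Rightarrow> 'p"
  on_hom :: "'o \<Rightarrow> 'o \<Rightarrow> 'm \<Rightarrow> 'n"

locale cat_functor = C: category C + D: category D
  for C :: "('o, 'm) cat" and D :: "('p, 'n) cat" +
  fixes F :: "('o, 'm, 'p, 'n) functor_data"
  assumes on_ob_in_Ob: "X \<in> Ob C \<Longrightarrow> on_ob F X \<in> Ob D"
    and on_hom_in_Hom:
      "\<lbrakk>X \<in> Ob C; Y \<in> Ob C; f \<in> Hom C X Y\<rbrakk>
        \<Longrightarrow> on_hom F X Y f \<in> Hom D (on_ob F X) (on_ob F Y)"
    and on_hom_Id: "X \<in> Ob C \<Longrightarrow> on_hom F X X (Id C X) = Id D (on_ob F X)"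
    and on_hom_Comp:
      "\<lbrakk>X \<in> Ob C; Y \<in> Ob C; Z \<in> Ob C; f \<in> Hom C X Y; g \<in> Hom C Y Z\<rbrakk>
        \<Longrightarrow> on_hom F X Z (Comp C X Y Z g f)
          = Comp D (on_ob F X) (on_ob F Y) (on_ob F Z) (on_hom F Y Z g) (on_hom F X Y f)"

definition id_functor :: "('o, 'm, 'o, 'm) functor_data" where
  "id_functor = \<lparr>on_ob = (\<lambda>X. X), on_hom = (\<lambda>X Y f. f)\<rparr>"

definition comp_functor ::
  "('p, 'n, 'q, 'k) functor_data \<Rightarrow> ('o, 'm, 'p, 'n) functor_data \<Rightarrow> ('o, 'm, 'q, 'k) functor_data"
where
  "comp_functor G F =
    \<lparr>on_ob = (\<lambda>X. on_ob G (on_ob F X)),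
     on_hom = (\<lambda>X Y f. on_hom G (on_ob F X) (on_ob F Y) (on_hom F X Y f))\<rparr>"

definition cat_iso :: "('o, 'm) cat \<Rightarrow> 'o \<Rightarrow> 'o \<Rightarrow> 'm \<Rightarrow> bool" where
  "cat_iso C X Y f \<longleftrightarrow> f \<in> Hom C X Y \<and>
    (\<exists>g \<in> Hom C Y X. Comp C X Y X g f = Id C X \<and> Comp C Y X Y f g = Id C Y)"

definition natural_iso ::
  "('o, 'm) cat \<Rightarrow> ('p, 'n) cat \<Rightarrow> ('o, 'm, 'p, 'n) functor_data \<Rightarrow> ('o, 'm, 'p, 'n) functor_data
    \<Rightarrow> ('o \<Rightarrow> 'n) \<Rightarrow> bool"
where
  "natural_iso C D F G \<eta> \<longleftrightarrow>
    (\<forall>X \<in> Ob C. cat_iso D (on_ob F X) (on_ob G X) (\<eta> X)) \<and>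
    (\<forall>X \<in> Ob C. \<forall>Y \<in> Ob C. \<forall>f \<in> Hom C X Y.
      Comp D (on_ob F X) (on_ob F Y) (on_ob G Y) (\<eta> Y) (on_hom F X Y f)
      = Comp D (on_ob F X) (on_ob G X) (on_ob G Y) (on_hom G X Y f) (\<eta> X))"

definition cat_equivalence ::
  "('o, 'm) cat \<Rightarrow> ('p, 'n) cat \<Rightarrow> ('o, 'm, 'p, 'n) functor_data \<Rightarrow> bool"
where
  "cat_equivalence C D F \<longleftrightarrow> cat_functor C D F \<and>
    (\<exists>G. cat_functor D C G \<and>
      (\<exists>\<eta>. natural_iso C C id_functor (comp_functor G F) \<eta>) \<and>
      (\<exists>\<epsilon>. natural_iso D D (comp_functor F G) id_functor \<epsilon>))"

section \<open>Real vector spaces with a carrier\<close>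

abbreviation real_field :: "real ring" where
  "real_field \<equiv> class_ring"

abbreviation linear_maps ::
  "(real, 'v, 'y) module_scheme \<Rightarrow> (real, 'w, 'z) module_scheme \<Rightarrow> ('v \<Rightarrow> 'w) set"
where
  "linear_maps \<equiv> LinearCombinations.module_hom real_field"

definition real_line :: "(real, real) module" where
  "real_line =
    \<lparr>carrier = UNIV, mult = (*), one = 1, zero = 0, add = (+), smult = (*)\<rparr>"

text \<open>
  The value of \<open>vectorspace.dim\<close> is only meaningful for spaces satisfying \<open>vectorspace.fin_dim\<close>.
\<close>

definition three_dimensional :: "(real, 'v, 'z) module_scheme \<Rightarrow> bool" where
  "three_dimensional V \<longleftrightarrow>
    vectorspace real_field V \<and> vectorspace.fin_dim real_field V \<and> vectorspace.dim real_field V = 3"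

definition bilinear_map ::
  "(real, 'u, 'x) module_scheme \<Rightarrow> (real, 'v, 'y) module_scheme \<Rightarrow> (real, 'w, 'z) module_scheme
    \<Rightarrow> ('u \<Rightarrow> 'v \<Rightarrow> 'w) \<Rightarrow> bool"
where
  "bilinear_map U V W B \<longleftrightarrow>
    (\<forall>a \<in> carrier U. (\<lambda>b. B a b) \<in> linear_maps V W) \<and>
    (\<forall>b \<in> carrier V. (\<lambda>a. B a b) \<in> linear_maps U W)"

definition ordered_basis :: "(real, 'v, 'z) module_scheme \<Rightarrow> 'v list \<Rightarrow> bool" where
  "ordered_basis V bs \<longleftrightarrow> distinct bs \<and> vectorspace.basis real_field V (set bs)"

definition same_orientation :: "(real, 'v, 'z) module_scheme \<Rightarrow> ('v list \<times> 'v list) set" where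
  "same_orientation V =
    {(bs, cs). ordered_basis V bs \<and> ordered_basis V cs \<and>
      (\<exists>A \<in> carrier_mat (length bs) (length bs). det A > 0 \<and>
        (\<forall>i < length bs. cs ! i = (\<Oplus>\<^bsub>V\<^esub> j \<in> {..<length bs}. (A $$ (i, j)) \<odot>\<^bsub>V\<^esub> (bs ! j))))}"

section \<open>Oriented inner product spaces of dimension 3\<close>

text \<open>
  The fields \<open>mult\<close> and \<open>one\<close> inherited from \<open>module\<close> carry no information here. The orientation is
  the set of the positively oriented ordered bases.
\<close>

record 'v oriented_space = "(real, 'v) module" +
  iprod :: "'v \<Rightarrow> 'v \<Rightarrow> real"
  orientation :: "'v list set"

definition inner_product :: "'v oriented_space \<Rightarrow> bool" where
  "inner_product V \<longleftrightarrow>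
    bilinear_map V V real_line (iprod V) \<and>
    (\<forall>a \<in> carrier V. \<forall>b \<in> carrier V. iprod V a b = iprod V b a) \<and>
    (\<forall>a \<in> carrier V. a \<noteq> \<zero>\<^bsub>V\<^esub> \<longrightarrow> iprod V a a > 0)"

definition oriented_space3 :: "'v oriented_space \<Rightarrow> bool" where
  "oriented_space3 V \<longleftrightarrow> three_dimensional V \<and> inner_product V \<and>
    orientation V \<in> {bs. ordered_basis V bs} // same_orientation V"

definition orthonormal :: "'v oriented_space \<Rightarrow> 'v list \<Rightarrow> bool" where
  "orthonormal V bs \<longleftrightarrow>
    (\<forall>i < length bs. \<forall>j < length bs. iprod V (bs ! i) (bs ! j) = (if i = j then 1 else 0))"

definition alternating_trilinear ::
  "'v oriented_space \<Rightarrow> ('v \<Rightarrow> 'v \<Rightarrow> 'v \<Rightarrow> real) \<Rightarrow> bool"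
where
  "alternating_trilinear V \<omega> \<longleftrightarrow>
    (\<forall>a \<in> carrier V. bilinear_map V V real_line (\<lambda>b c. \<omega> a b c)) \<and>
    (\<forall>b \<in> carrier V. bilinear_map V V real_line (\<lambda>a c. \<omega> a b c)) \<and>
    (\<forall>a \<in> carrier V. \<forall>b \<in> carrier V. \<omega> a a b = 0 \<and> \<omega> a b a = 0 \<and> \<omega> b a a = 0)"

text \<open>
  The volume form is unique as a form on the carrier; \<open>SOME\<close> only chooses its values at arguments
  outside the carrier.
\<close>

definition volume_form :: "'v oriented_space \<Rightarrow> 'v \<Rightarrow> 'v \<Rightarrow> 'v \<Rightarrow> real" where
  "volume_form V = (SOME \<omega>. alternating_trilinear V \<omega> \<and>
    (\<forall>bs \<in> orientation V. orthonormal V bs \<longrightarrow> \<omega> (bs ! 0) (bs ! 1) (bs ! 2) = 1))"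

definition cross :: "'v oriented_space \<Rightarrow> 'v \<Rightarrow> 'v \<Rightarrow> 'v" where
  "cross V a b =
    (THE v. v \<in> carrier V \<and> (\<forall>c \<in> carrier V. iprod V v c = volume_form V a b c))"

definition oriented_isometries :: "'v oriented_space \<Rightarrow> 'v oriented_space \<Rightarrow> ('v \<Rightarrow> 'v) set" where
  "oriented_isometries V W =
    {f \<in> extensional (carrier V). f \<in> linear_maps V W \<and>
      (\<forall>a \<in> carrier V. \<forall>b \<in> carrier V. iprod W (f a) (f b) = iprod V a b) \<and>
      (\<forall>bs \<in> orientation V. map f bs \<in> orientation W)}"

text \<open>
  The underlying sets are subsets of a type \<open>'v\<close>, which plays the role of a universe; correspondingly
  the algebras below live in \<open>real \<times> 'v\<close>. A universe without room for the real numbers contains no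
  3-dimensional real space. Arrows are extensional, so that equality of arrows is equality on the
  carrier of the domain.
\<close>

definition oriented_spaces :: "('v oriented_space, 'v \<Rightarrow> 'v) cat" where
  "oriented_spaces =
    \<lparr>Ob = {V. oriented_space3 V},
     Hom = oriented_isometries,
     Id = (\<lambda>V. \<lambda>a \<in> carrier V. a),
     Comp = (\<lambda>U V W g f. compose (carrier U) g f)\<rparr>"

section \<open>Real algebras isomorphic to the quaternions\<close>

definition real_algebra :: "(real, 'a) module \<Rightarrow> bool" where
  "real_algebra A \<longleftrightarrow>
    vectorspace real_field A \<and> vectorspace.fin_dim real_field A \<and>
    bilinear_map A A A (mult A) \<and>
    \<one>\<^bsub>A\<^esub> \<in> carrier A \<and>
    (\<forall>x \<in> carrier A. \<one>\<^bsub>A\<^esub> \<otimes>\<^bsub>A\<^esub> x = x \<and> x \<otimes>\<^bsub>A\<^esub> \<one>\<^bsub>A\<^esub> = x)"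

definition algebra_isos :: "(real, 'a) module \<Rightarrow> (real, 'b) module \<Rightarrow> ('a \<Rightarrow> 'b) set" where
  "algebra_isos A B =
    {f \<in> extensional (carrier A). f \<in> linear_maps A B \<and> bij_betw f (carrier A) (carrier B) \<and>
      f \<one>\<^bsub>A\<^esub> = \<one>\<^bsub>B\<^esub> \<and>
      (\<forall>x \<in> carrier A. \<forall>y \<in> carrier A. f (x \<otimes>\<^bsub>A\<^esub> y) = f x \<otimes>\<^bsub>B\<^esub> f y)}"

text \<open>\<open>(a, b, c, d)\<close> stands for \<open>a + bi + cj + dk\<close>.\<close>

definition quaternions :: "(real, real \<times> real \<times> real \<times> real) module" where
  "quaternions =
    \<lparr>carrier = UNIV,
     mult = (\<lambda>(a, b, c, d) (a', b', c', d').
       (a * a' - b * b' - c * c' - d * d',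
        a * b' + b * a' + c * d' - d * c',
        a * c' - b * d' + c * a' + d * b',
        a * d' + b * c' - c * b' + d * a')),
     one = (1, 0, 0, 0),
     zero = (0, 0, 0, 0),
     add = (\<lambda>(a, b, c, d) (a', b', c', d'). (a + a', b + b', c + c', d + d')),
     smult = (\<lambda>r (a, b, c, d). (r * a, r * b, r * c, r * d))\<rparr>"

definition quaternion_algebras :: "((real, 'a) module, 'a \<Rightarrow> 'a) cat" where
  "quaternion_algebras =
    \<lparr>Ob = {A. real_algebra A \<and> algebra_isos A quaternions \<noteq> {}},
     Hom = algebra_isos,
     Id = (\<lambda>A. \<lambda>x \<in> carrier A. x),
     Comp = (\<lambda>A B C g f. compose (carrier A) g f)\<rparr>"

section \<open>The functor from oriented spaces to quaternion algebras\<close>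

definition H_ob :: "'v oriented_space \<Rightarrow> (real, real \<times> 'v) module" where
  "H_ob V = (direct_sum real_line V)
    \<lparr>mult := (\<lambda>(\<alpha>, a) (\<beta>, b).
       (\<alpha> * \<beta> - iprod V a b, (\<alpha> \<odot>\<^bsub>V\<^esub> b) \<oplus>\<^bsub>V\<^esub> (\<beta> \<odot>\<^bsub>V\<^esub> a) \<oplus>\<^bsub>V\<^esub> cross V a b)),
     one := (1, \<zero>\<^bsub>V\<^esub>)\<rparr>"

text \<open>An arrow \<open>f\<close> is sent to \<open>id \<oplus> f\<close>.\<close>

definition H_functor ::
  "('v oriented_space, 'v \<Rightarrow> 'v, (real, real \<times> 'v) module, real \<times> 'v \<Rightarrow> real \<times> 'v)
    functor_data"
where
  "H_functor =
    \<lparr>on_ob = H_ob,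
     on_hom = (\<lambda>V W f. \<lambda>(\<alpha>, a) \<in> UNIV \<times> carrier V. (\<alpha>, f a))\<rparr>"

end

theory Submission
  imports Defs
begin

text \<open>
  A functor is an equivalence if it is full, faithful and essentially surjective
  (\<open>cat_equivalenceI\<close>), and everything about oriented spaces of dimension 3 can be read off from a
  positively oriented orthonormal basis \<open>i\<close>, \<open>j\<close>, \<open>k\<close> (locale \<open>oriented_frame\<close>), which exists by
  Gram-Schmidt, after exchanging two vectors if the sign is wrong. In its coordinates the inner
  product is the dot product, the volume form is the determinant, a basis is positive iff its
  determinant is, and the cross product has its usual formula. It follows that

  \<^item> \<open>H(V)\<close> is an algebra, and taking coordinates is an isomorphism from \<open>H(V)\<close> to the quaternions
    (\<open>quaternion_coords_iso\<close>);
  \<^item> an orientation-preserving isometry \<open>f\<close> maps such a basis to such a basis, so it preserves cross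
    products and \<open>id \<oplus> f\<close> is an algebra isomorphism (\<open>H_hom_in_algebra_isos\<close>).

  Faithfulness is clear. For fullness (\<open>H_full\<close>), an algebra isomorphism \<open>h\<close> fixes the real line,
  and it maps \<open>V\<close> to \<open>W\<close>, because the elements of \<open>V\<close> are those whose square is a nonpositive real
  number. So \<open>h = id \<oplus> f\<close>. The product of two vectors is \<open>(- a \<cdot> b, a \<times> b)\<close>, so \<open>f\<close> preserves the
  inner product and the cross product, hence also the triple product, which is the volume form, hence
  the orientation.

  For essential surjectivity, all objects of the target are isomorphic to the quaternions, so a
  single oriented space is enough. It is a copy of \<open>\<real>\<^sup>3\<close> inside the universe, which has room for it
  because it has room for \<open>\<real>\<close>.
\<close>

section \<open>Fully faithful, essentially surjective functors\<close>

text \<open>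
  Choosing for every object \<open>A\<close> of \<open>D\<close> an object \<open>S A\<close> of \<open>C\<close> and an isomorphism \<open>F (S A) \<cong> A\<close>
  makes \<open>S\<close> a functor: conjugate an arrow by the chosen isomorphisms and pull it back along \<open>F\<close>.
  Faithfulness turns every equation to be checked in \<open>C\<close> into one in \<open>D\<close>.
\<close>

lemma cat_equivalenceI:
  assumes F: "cat_functor C D F"
    and full: "\<And>X Y h. \<lbrakk>X \<in> Ob C; Y \<in> Ob C; h \<in> Hom D (on_ob F X) (on_ob F Y)\<rbrakk>
        \<Longrightarrow> \<exists>f \<in> Hom C X Y. on_hom F X Y f = h"
    and faithful: "\<And>X Y f g. \<lbrakk>X \<in> Ob C; Y \<in> Ob C; f \<in> Hom C X Y; g \<in> Hom C X Y;
        on_hom F X Y f = on_hom F X Y g\<rbrakk> \<Longrightarrow> f = g"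
    and ess_surj: "\<And>A. A \<in> Ob D \<Longrightarrow> \<exists>X \<in> Ob C. \<exists>h. cat_iso D (on_ob F X) A h"
  shows "cat_equivalence C D F"
proof -
  interpret F: cat_functor C D F by (rule F)
  let ?F = "on_ob F"
  have "\<forall>A \<in> Ob D. \<exists>X h k. X \<in> Ob C \<and> h \<in> Hom D (?F X) A \<and> k \<in> Hom D A (?F X) \<and>
      Comp D (?F X) A (?F X) k h = Id D (?F X) \<and> Comp D A (?F X) A h k = Id D A"
    using ess_surj unfolding cat_iso_def by blast
  then obtain S e d where
    S: "\<And>A. A \<in> Ob D \<Longrightarrow> S A \<in> Ob C" and
    e: "\<And>A. A \<in> Ob D \<Longrightarrow> e A \<in> Hom D (?F (S A)) A" and
    d: "\<And>A. A \<in> Ob D \<Longrightarrow> d A \<in> Hom D A (?F (S A))" and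
    de: "\<And>A. A \<in> Ob D \<Longrightarrow> Comp D (?F (S A)) A (?F (S A)) (d A) (e A) = Id D (?F (S A))" and
    ed: "\<And>A. A \<in> Ob D \<Longrightarrow> Comp D A (?F (S A)) A (e A) (d A) = Id D A"
    by metis
  have FS: "\<And>A. A \<in> Ob D \<Longrightarrow> ?F (S A) \<in> Ob D"
    using S F.on_ob_in_Ob by blast
  define lift where "lift X Y h = (SOME f. f \<in> Hom C X Y \<and> on_hom F X Y f = h)" for X Y h
  have lift: "lift X Y h \<in> Hom C X Y \<and> on_hom F X Y (lift X Y h) = h"
    if "X \<in> Ob C" "Y \<in> Ob C" "h \<in> Hom D (?F X) (?F Y)" for X Y h
    unfolding lift_def using someI_ex[of "\<lambda>f. f \<in> Hom C X Y \<and> on_hom F X Y f = h"]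
      full[OF that] by blast
  note lift_in = lift[THEN conjunct1] and F_lift = lift[THEN conjunct2]
  define conj where "conj A B h =
    Comp D (?F (S A)) A (?F (S B)) (Comp D A B (?F (S B)) (d B) h) (e A)" for A B h
  have conj_in: "conj A B h \<in> Hom D (?F (S A)) (?F (S B))"
    if "A \<in> Ob D" "B \<in> Ob D" "h \<in> Hom D A B" for A B h
    unfolding conj_def using that FS e d by (blast intro: F.D.Comp_in_Hom)
  have e_conj: "Comp D (?F (S A)) (?F (S B)) B (e B) (conj A B h) = Comp D (?F (S A)) A B h (e A)"
    if "A \<in> Ob D" "B \<in> Ob D" "h \<in> Hom D A B" for A B h
  proof -
    have dh: "Comp D A B (?F (S B)) (d B) h \<in> Hom D A (?F (S B))"
      using that FS d by (blast intro: F.D.Comp_in_Hom)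
    have "Comp D (?F (S A)) (?F (S B)) B (e B) (conj A B h)
        = Comp D (?F (S A)) A B (Comp D A (?F (S B)) B (e B) (Comp D A B (?F (S B)) (d B) h)) (e A)"
      unfolding conj_def using F.D.Comp_assoc[OF FS _ FS _ e dh e] that by metis
    also have "Comp D A (?F (S B)) B (e B) (Comp D A B (?F (S B)) (d B) h) = h"
      using F.D.Comp_assoc[OF _ _ FS _ _ d e] ed F.D.Comp_Id_left that by metis
    finally show ?thesis .
  qed
  have conj_unique: "k = conj A B h"
    if AB: "A \<in> Ob D" "B \<in> Ob D" "h \<in> Hom D A B" and k: "k \<in> Hom D (?F (S A)) (?F (S B))"
      and eq: "Comp D (?F (S A)) (?F (S B)) B (e B) k = Comp D (?F (S A)) A B h (e A)" for A B h k
  proof -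
    have *: "k' = Comp D (?F (S A)) B (?F (S B)) (d B) (Comp D (?F (S A)) (?F (S B)) B (e B) k')"
      if "k' \<in> Hom D (?F (S A)) (?F (S B))" for k'
      using F.D.Comp_assoc[OF FS FS _ FS that e d] de F.D.Comp_Id_left[OF FS FS that] AB by metis
    show ?thesis
      using *[OF k] *[OF conj_in[OF AB]] eq e_conj[OF AB] by metis
  qed
  define G where "G = \<lparr>on_ob = S, on_hom = (\<lambda>A B h. lift (S A) (S B) (conj A B h))\<rparr>"
  have G_ob: "on_ob G A = S A" and G_hom: "on_hom G A B h = lift (S A) (S B) (conj A B h)" for A B h
    by (simp_all add: G_def)
  have FG: "on_hom F (S A) (S B) (on_hom G A B h) = conj A B h"
    if "A \<in> Ob D" "B \<in> Ob D" "h \<in> Hom D A B" for A B h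
    unfolding G_hom using that by (simp add: F_lift S conj_in)
  have G_in: "on_hom G A B h \<in> Hom C (S A) (S B)"
    if "A \<in> Ob D" "B \<in> Ob D" "h \<in> Hom D A B" for A B h
    unfolding G_hom using that by (simp add: lift_in S conj_in)
  have G: "cat_functor D C G"
  proof unfold_locales
    fix A B h assume "A \<in> Ob D" "B \<in> Ob D" "h \<in> Hom D A B"
    then show "on_hom G A B h \<in> Hom C (on_ob G A) (on_ob G B)" by (simp add: G_ob G_in)
  next
    fix A assume A: "A \<in> Ob D"
    have "Id D (?F (S A)) = conj A A (Id D A)"
      using A FS e by (intro conj_unique) (simp_all add: F.D.Id_in_Hom F.D.Comp_Id_left F.D.Comp_Id_right)
    then show "on_hom G A A (Id D A) = Id C (on_ob G A)"
      unfolding G_ob using A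
      by (intro faithful[of "S A" "S A"]) (simp_all add: S G_in F.C.Id_in_Hom F.D.Id_in_Hom FG F.on_hom_Id)
  next
    fix A B E g h
    assume ABE: "A \<in> Ob D" "B \<in> Ob D" "E \<in> Ob D" and g: "g \<in> Hom D A B" and h: "h \<in> Hom D B E"
    let ?gh = "Comp D A B E h g"
    have gh: "?gh \<in> Hom D A E" using F.D.Comp_in_Hom[OF ABE g h] .
    note inn = conj_in[OF ABE(1,2) g] conj_in[OF ABE(2,3) h]
    have "Comp D (?F (S A)) (?F (S B)) (?F (S E)) (conj B E h) (conj A B g) = conj A E ?gh"
    proof (rule conj_unique[OF ABE(1,3) gh])
      show "Comp D (?F (S A)) (?F (S B)) (?F (S E)) (conj B E h) (conj A B g)
          \<in> Hom D (?F (S A)) (?F (S E))"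
        using F.D.Comp_in_Hom[OF _ _ _ inn] ABE FS by blast
      have "Comp D (?F (S A)) (?F (S E)) E (e E)
            (Comp D (?F (S A)) (?F (S B)) (?F (S E)) (conj B E h) (conj A B g))
          = Comp D (?F (S A)) (?F (S B)) E
            (Comp D (?F (S B)) (?F (S E)) E (e E) (conj B E h)) (conj A B g)"
        using F.D.Comp_assoc[OF _ _ _ _ inn e] ABE FS by metis
      also have "\<dots> = Comp D (?F (S A)) (?F (S B)) E (Comp D (?F (S B)) B E h (e B)) (conj A B g)"
        by (simp add: e_conj ABE h)
      also have "\<dots> = Comp D (?F (S A)) B E h (Comp D (?F (S A)) (?F (S B)) B (e B) (conj A B g))"
        using F.D.Comp_assoc[OF _ _ _ _ inn(1) e h] ABE FS by metis
      also have "\<dots> = Comp D (?F (S A)) B E h (Comp D (?F (S A)) A B g (e A))"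
        by (simp add: e_conj ABE g)
      also have "\<dots> = Comp D (?F (S A)) A E ?gh (e A)"
        using F.D.Comp_assoc[OF _ _ _ _ e g h] ABE FS by metis
      finally show "Comp D (?F (S A)) (?F (S E)) E (e E)
            (Comp D (?F (S A)) (?F (S B)) (?F (S E)) (conj B E h) (conj A B g))
          = Comp D (?F (S A)) A E ?gh (e A)" .
    qed
    then show "on_hom G A E ?gh
        = Comp C (on_ob G A) (on_ob G B) (on_ob G E) (on_hom G B E h) (on_hom G A B g)"
      unfolding G_ob using ABE g h gh
      by (intro faithful[of "S A" "S E"])
        (simp_all add: S G_in FG F.on_hom_Comp F.C.Comp_in_Hom[of "S A" "S B" "S E"])
  qed (simp add: G_ob S)
  define \<eta> where "\<eta> X = lift X (S (?F X)) (d (?F X))" for X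
  define \<theta> where "\<theta> X = lift (S (?F X)) X (e (?F X))" for X
  have \<eta>: "\<eta> X \<in> Hom C X (S (?F X))" "on_hom F X (S (?F X)) (\<eta> X) = d (?F X)" 
    and \<theta>: "\<theta> X \<in> Hom C (S (?F X)) X" "on_hom F (S (?F X)) X (\<theta> X) = e (?F X)" 
    if "X \<in> Ob C" for X
    using that S d e F.on_ob_in_Ob unfolding \<eta>_def \<theta>_def by (simp_all add: lift)
  have \<eta>_iso: "cat_iso C X (S (?F X)) (\<eta> X)" if X: "X \<in> Ob C" for X
    unfolding cat_iso_def
  proof (intro conjI bexI[where x = "\<theta> X"])
    note o = X S[OF F.on_ob_in_Ob[OF X]]
    show "Comp C X (S (?F X)) X (\<theta> X) (\<eta> X) = Id C X"
      by (rule faithful[of X X]) (use o \<eta> \<theta> ed in \<open>simp_all add: F.on_hom_Comp F.on_hom_Id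
        F.C.Comp_in_Hom[of X "S (?F X)" X] F.C.Id_in_Hom F.on_ob_in_Ob\<close>)
    show "Comp C (S (?F X)) X (S (?F X)) (\<eta> X) (\<theta> X) = Id C (S (?F X))"
      by (rule faithful[of "S (?F X)" "S (?F X)"]) (use o \<eta> \<theta> de in \<open>simp_all add: F.on_hom_Comp F.on_hom_Id
        F.C.Comp_in_Hom[of "S (?F X)" X "S (?F X)"] F.C.Id_in_Hom F.on_ob_in_Ob\<close>)
  qed (use X \<eta> \<theta> in auto)
  have "natural_iso C C id_functor (comp_functor G F) \<eta>"
    unfolding natural_iso_def
  proof (intro conjI ballI)
    fix X assume "X \<in> Ob C"
    then show "cat_iso C (on_ob id_functor X) (on_ob (comp_functor G F) X) (\<eta> X)"
      by (simp add: id_functor_def comp_functor_def G_ob \<eta>_iso)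
  next
    fix X Y f assume X: "X \<in> Ob C" and Y: "Y \<in> Ob C" and f: "f \<in> Hom C X Y"
    note o = F.on_ob_in_Ob[OF X] F.on_ob_in_Ob[OF Y]
    note f' = F.on_hom_in_Hom[OF X Y f]
    note S' = S[OF o(1)] S[OF o(2)]
    have "Comp D (?F X) (?F (S (?F X))) (?F (S (?F Y))) (conj (?F X) (?F Y) (on_hom F X Y f)) (d (?F X))
        = Comp D (?F X) (?F X) (?F (S (?F Y))) (Comp D (?F X) (?F Y) (?F (S (?F Y))) (d (?F Y)) (on_hom F X Y f))
           (Comp D (?F X) (?F (S (?F X))) (?F X) (e (?F X)) (d (?F X)))"
      unfolding conj_def
      using F.D.Comp_assoc[OF o(1) FS[OF o(1)] o(1) FS[OF o(2)] d[OF o(1)] e[OF o(1)]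
        F.D.Comp_in_Hom[OF o FS[OF o(2)] f' d[OF o(2)]]] .
    also have "\<dots> = Comp D (?F X) (?F Y) (?F (S (?F Y))) (d (?F Y)) (on_hom F X Y f)"
      using F.D.Comp_Id_right[OF o(1) FS[OF o(2)] F.D.Comp_in_Hom[OF o FS[OF o(2)] f' d[OF o(2)]]]
      by (simp add: ed[OF o(1)])
    finally have nat: "Comp D (?F X) (?F (S (?F X))) (?F (S (?F Y))) (conj (?F X) (?F Y) (on_hom F X Y f)) (d (?F X))
        = Comp D (?F X) (?F Y) (?F (S (?F Y))) (d (?F Y)) (on_hom F X Y f)" .
    have "Comp C X Y (S (?F Y)) (\<eta> Y) f
        = Comp C X (S (?F X)) (S (?F Y)) (on_hom G (?F X) (?F Y) (on_hom F X Y f)) (\<eta> X)"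
      by (rule faithful[of X "S (?F Y)"])
        (use X Y f o f' S' \<eta> nat in \<open>simp_all add: F.on_hom_Comp FG G_in
          F.C.Comp_in_Hom[of X Y "S (?F Y)"] F.C.Comp_in_Hom[of X "S (?F X)" "S (?F Y)"]\<close>)
    then show "Comp C (on_ob id_functor X) (on_ob id_functor Y) (on_ob (comp_functor G F) Y) (\<eta> Y)
          (on_hom id_functor X Y f)
        = Comp C (on_ob id_functor X) (on_ob (comp_functor G F) X) (on_ob (comp_functor G F) Y)
          (on_hom (comp_functor G F) X Y f) (\<eta> X)"
      by (simp add: id_functor_def comp_functor_def G_ob)
  qed
  moreover have "natural_iso D D (comp_functor F G) id_functor e"
    unfolding natural_iso_def cat_iso_def id_functor_def comp_functor_def
    using e d de ed e_conj by (auto simp: G_ob FG intro!: bexI[where x = "d _"])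
  ultimately show ?thesis
    unfolding cat_equivalence_def using F G by blast
qed

section \<open>Orthonormal bases and coordinates\<close>

lemma linear_maps_iff:
  "f \<in> linear_maps V W \<longleftrightarrow> f \<in> carrier V \<rightarrow> carrier W \<and>
    (\<forall>a \<in> carrier V. \<forall>b \<in> carrier V. f (a \<oplus>\<^bsub>V\<^esub> b) = f a \<oplus>\<^bsub>W\<^esub> f b) \<and>
    (\<forall>r. \<forall>a \<in> carrier V. f (r \<odot>\<^bsub>V\<^esub> a) = r \<odot>\<^bsub>W\<^esub> f a)"
  by (auto simp: LinearCombinations.module_hom_def)

lemma real_line_simps [simp]:
  "carrier real_line = UNIV" "x \<oplus>\<^bsub>real_line\<^esub> y = x + y" "x \<odot>\<^bsub>real_line\<^esub> y = x * y"
  "\<zero>\<^bsub>real_line\<^esub> = 0"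
  by (simp_all add: real_line_def)

lemma det_3:
  assumes A: "A \<in> carrier_mat 3 3"
  shows "det (A :: 'a :: comm_ring_1 mat) =
      A $$ (0,0) * (A $$ (1,1) * A $$ (2,2) - A $$ (1,2) * A $$ (2,1))
    - A $$ (0,1) * (A $$ (1,0) * A $$ (2,2) - A $$ (1,2) * A $$ (2,0))
    + A $$ (0,2) * (A $$ (1,0) * A $$ (2,1) - A $$ (1,1) * A $$ (2,0))"
proof -
  have two: "det B = B $$ (0,0) * B $$ (1,1) - B $$ (0,1) * B $$ (1,0)"
    if B: "B \<in> carrier_mat 2 2" for B :: "'a mat"
    using laplace_expansion_row[OF B, of 0] B
    by (simp add: cofactor_def numeral_2_eq_2 mat_delete_def det_single)
  show ?thesis
    using laplace_expansion_row[OF A, of 0] A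
    by (simp add: cofactor_def numeral_3_eq_3 mat_delete_def two numeral_2_eq_2 algebra_simps)
qed

locale inner_product_space = vectorspace real_field V
  for V :: "'v oriented_space" (structure) +
  assumes inner_product: "inner_product V"
begin

abbreviation ip :: "'v \<Rightarrow> 'v \<Rightarrow> real" where "ip \<equiv> iprod V"

lemma vec_smult_closed [simp, intro]: "a \<in> carrier V \<Longrightarrow> r \<odot> a \<in> carrier V"
  using smult_closed[of r a] by simp

lemma ip_sym: "a \<in> carrier V \<Longrightarrow> b \<in> carrier V \<Longrightarrow> ip a b = ip b a"
  using inner_product by (simp add: inner_product_def)

lemma ip_pos: "a \<in> carrier V \<Longrightarrow> a \<noteq> \<zero> \<Longrightarrow> ip a a > 0"
  using inner_product by (simp add: inner_product_def)

lemma ip_add [simp]: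
  assumes "a \<in> carrier V" "b \<in> carrier V" "c \<in> carrier V"
  shows "ip (a \<oplus> b) c = ip a c + ip b c" "ip c (a \<oplus> b) = ip c a + ip c b"
  using inner_product assms
  by (simp_all add: inner_product_def bilinear_map_def linear_maps_iff)

lemma ip_smult [simp]:
  assumes "a \<in> carrier V" "c \<in> carrier V"
  shows "ip (r \<odot> a) c = r * ip a c" "ip c (r \<odot> a) = r * ip c a"
  using inner_product assms
  by (simp_all add: inner_product_def bilinear_map_def linear_maps_iff)

lemma ip_zero [simp]:
  assumes "a \<in> carrier V"
  shows "ip \<zero> a = 0" "ip a \<zero> = 0"
  using ip_add[of \<zero> \<zero> a] assms by simp_all

lemma orth_zero:
  assumes "a \<in> carrier V" "ip a a = 0"
  shows "a = \<zero>"
  using ip_pos assms by fastforce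

lemma eq_if_diff_norm_zero:
  assumes "a \<in> carrier V" "b \<in> carrier V" "ip (a \<oplus> (-1) \<odot> b) (a \<oplus> (-1) \<odot> b) = 0"
  shows "a = b"
proof -
  have "a \<oplus> (-1) \<odot> b = \<zero>" using assms by (intro orth_zero) simp_all
  moreover have "(-1) \<odot> b = \<ominus> b"
    using smult_minus_1[of b] assms by (simp add: class_ring_simps)
  ultimately have "\<ominus> (\<ominus> b) = a" using assms by (intro minus_equality) simp_all
  then show ?thesis using assms by simp
qed

lemma lincomb_3:
  assumes "a \<in> carrier V" "b \<in> carrier V" "c \<in> carrier V" "distinct [a, b, c]"
  shows "lincomb f {a, b, c} = f a \<odot> a \<oplus> (f b \<odot> b \<oplus> f c \<odot> c)"
  using assms by (simp add: lincomb_def)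

lemma lin_indpt_3I:
  assumes "a \<in> carrier V" "b \<in> carrier V" "c \<in> carrier V" "distinct [a, b, c]"
    and "\<And>x y z. x \<odot> a \<oplus> (y \<odot> b \<oplus> z \<odot> c) = \<zero> \<Longrightarrow> x = 0 \<and> y = 0 \<and> z = 0"
  shows "lin_indpt {a, b, c}"
  using assms by (intro finite_lin_indpt2) (auto simp: lincomb_3)

lemma span_3:
  assumes "a \<in> carrier V" "b \<in> carrier V" "c \<in> carrier V" "distinct [a, b, c]"
  shows "v \<in> span {a, b, c} \<longleftrightarrow> (\<exists>x y z. v = x \<odot> a \<oplus> (y \<odot> b \<oplus> z \<odot> c))"
proof
  assume "v \<in> span {a, b, c}"
  then show "\<exists>x y z. v = x \<odot> a \<oplus> (y \<odot> b \<oplus> z \<odot> c)"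
    using assms by (auto simp: finite_span lincomb_3)
next
  assume "\<exists>x y z. v = x \<odot> a \<oplus> (y \<odot> b \<oplus> z \<odot> c)"
  then obtain x y z where v: "v = x \<odot> a \<oplus> (y \<odot> b \<oplus> z \<odot> c)" by blast
  let ?f = "\<lambda>w. if w = a then x else if w = b then y else z"
  have "lincomb ?f {a, b, c} = v"
    using assms by (subst lincomb_3) (auto simp: v)
  then show "v \<in> span {a, b, c}"
    using assms by (force simp: finite_span)
qed

text \<open>
  One Gram-Schmidt step: if the span of an orthonormal family is not everything, then a vector
  outside it minus its projection is nonzero, so it can be normalised.
\<close>

lemma exists_unit_orthogonal:
  assumes fin_dim: "fin_dim" and S: "finite S" "S \<subseteq> carrier V" "card S < dim"
    and on: "\<And>u v. u \<in> S \<Longrightarrow> v \<in> S \<Longrightarrow> ip u v = (if u = v then 1 else 0)"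
  shows "\<exists>w \<in> carrier V. ip w w = 1 \<and> (\<forall>u \<in> S. ip w u = 0)"
proof -
  have "\<not> gen_set S" using gen_ge_dim[of S] S by linarith
  then obtain v where v: "v \<in> carrier V" "v \<notin> span S" 
    using span_is_subset2[of S] S by blast
  have ip_lc: "ip (lincomb f T) u = (\<Sum>w\<in>T. f w * ip w u)"
    if "finite T" "T \<subseteq> S" "u \<in> carrier V" for f T u
    using that
  proof (induction T)
    case (insert w T)
    have "lincomb f (insert w T) = f w \<odot> w \<oplus> lincomb f T"
      using insert S lincomb_insert[of T f w] by auto
    moreover have "lincomb f T \<in> carrier V" "w \<in> carrier V"
      using insert S by (auto intro!: lincomb_closed)
    ultimately show ?case using insert by simp
  qed (simp add: lincomb_def)
  define p where "p = lincomb (\<lambda>u. ip v u) S"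
  have p: "p \<in> carrier V" "p \<in> span S"
    unfolding p_def using S by (auto simp: finite_span intro!: lincomb_closed)
  define w where "w = v \<oplus> (-1) \<odot> p"
  have w: "w \<in> carrier V" using v p by (simp add: w_def)
  have orth: "ip w u = 0" if u: "u \<in> S" for u
  proof -
    have "ip p u = (\<Sum>x\<in>S. ip v x * (if x = u then 1 else 0))"
      unfolding p_def using u S on by (subst ip_lc) (auto intro!: sum.cong)
    also have "\<dots> = ip v u" using u S by (simp add: if_distrib cong: if_cong)
    finally show ?thesis using u S v p by (simp add: w_def subset_iff)
  qed
  have "w \<noteq> \<zero>"
  proof
    assume "w = \<zero>"
    then have "v = p" using eq_if_diff_norm_zero[of v p] v p by (simp add: w_def[symmetric])
    then show False using v p by blast
  qed
  then have pos: "ip w w > 0" using ip_pos w by blast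
  let ?u = "(1 / sqrt (ip w w)) \<odot> w"
  have "ip ?u ?u = 1" using w pos by (simp add: divide_simps)
  then show ?thesis using w orth S by (intro bexI[of _ ?u]) (auto simp: subset_iff)
qed

end

lemma inner_product_space_of_oriented_space3:
  "oriented_space3 V \<Longrightarrow> inner_product_space V"
  by (simp add: oriented_space3_def three_dimensional_def inner_product_space_def
    inner_product_space_axioms_def)

locale orthonormal_basis3 = inner_product_space V
  for V :: "'v oriented_space" (structure) +
  fixes i j k :: 'v
  assumes ijk_closed [simp]: "i \<in> carrier V" "j \<in> carrier V" "k \<in> carrier V"
    and ip_ijk [simp]: "ip i i = 1" "ip j j = 1" "ip k k = 1" "ip i j = 0" "ip j i = 0"
      "ip i k = 0" "ip k i = 0" "ip j k = 0" "ip k j = 0"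
    and ijk_spans: "a \<in> carrier V \<Longrightarrow> \<exists>x y z. a = x \<odot> i \<oplus> (y \<odot> j \<oplus> z \<odot> k)"
begin

definition vec :: "real \<Rightarrow> real \<Rightarrow> real \<Rightarrow> 'v" where
  "vec x y z = x \<odot> i \<oplus> (y \<odot> j \<oplus> z \<odot> k)"

lemma vec_closed [simp]: "vec x y z \<in> carrier V"
  by (simp add: vec_def)

lemma coord_vec [simp]: "ip (vec x y z) i = x" "ip (vec x y z) j = y" "ip (vec x y z) k = z"
  by (simp_all add: vec_def)

lemma vec_coord [simp]: "a \<in> carrier V \<Longrightarrow> vec (ip a i) (ip a j) (ip a k) = a"
  using ijk_spans[of a] coord_vec by (auto simp: vec_def[symmetric])

lemma eq_by_coords:
  assumes "a \<in> carrier V" "b \<in> carrier V" "ip a i = ip b i" "ip a j = ip b j" "ip a k = ip b k"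
  shows "a = b"
  using vec_coord assms by metis

lemma ip_coords:
  assumes "a \<in> carrier V" "b \<in> carrier V"
  shows "ip a b = ip a i * ip b i + ip a j * ip b j + ip a k * ip b k"
proof -
  have "ip a b = ip a (vec (ip b i) (ip b j) (ip b k))" using assms by simp
  also have "\<dots> = ip a i * ip b i + ip a j * ip b j + ip a k * ip b k"
    using assms by (simp only: vec_def) simp
  finally show ?thesis .
qed

text \<open>
  The determinant of the coordinates; when \<open>i\<close>, \<open>j\<close>, \<open>k\<close> is positively oriented, this is the volume form.
\<close>

definition trip :: "'v \<Rightarrow> 'v \<Rightarrow> 'v \<Rightarrow> real" where
  "trip a b c =
      ip a i * (ip b j * ip c k - ip b k * ip c j)
    - ip a j * (ip b i * ip c k - ip b k * ip c i)
    + ip a k * (ip b i * ip c j - ip b j * ip c i)"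

lemma trip_ijk [simp]: "trip i j k = 1" "trip j i k = -1"
  by (simp_all add: trip_def)

lemma trip_linear_combination:
  assumes "a \<in> carrier V" "b \<in> carrier V" "c \<in> carrier V" and A: "A \<in> carrier_mat 3 3"
  shows "trip (A $$ (0,0) \<odot> a \<oplus> (A $$ (0,1) \<odot> b \<oplus> A $$ (0,2) \<odot> c))
      (A $$ (1,0) \<odot> a \<oplus> (A $$ (1,1) \<odot> b \<oplus> A $$ (1,2) \<odot> c))
      (A $$ (2,0) \<odot> a \<oplus> (A $$ (2,1) \<odot> b \<oplus> A $$ (2,2) \<odot> c)) = det A * trip a b c"
  using assms(1-3) by (simp add: trip_def det_3[OF A]) (simp only: algebra_simps)

lemma trip_alternating:
  "trip a a b = 0" "trip a b a = 0" "trip b a a = 0"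
  by (simp_all add: trip_def algebra_simps)

lemma distinct_ijk: "distinct [i, j, k]"
  using ip_ijk by (metis distinct_length_2_or_more distinct_singleton zero_neq_one)

lemma basis_ijk: "basis {i, j, k}"
proof -
  have "lin_indpt {i, j, k}"
  proof (rule lin_indpt_3I)
    fix x y z assume "x \<odot> i \<oplus> (y \<odot> j \<oplus> z \<odot> k) = \<zero>"
    then have "vec x y z = \<zero>" by (simp add: vec_def)
    then have "x = ip \<zero> i" "y = ip \<zero> j" "z = ip \<zero> k" using coord_vec by metis+
    then show "x = 0 \<and> y = 0 \<and> z = 0" by simp
  qed (use distinct_ijk in auto)
  moreover have "span {i, j, k} = carrier V"
    using ijk_spans distinct_ijk by (auto simp: span_3)
  ultimately show ?thesis by (simp add: basis_def)
qed

lemma three_dimensional: "three_dimensional V"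
proof -
  have "fin_dim" unfolding fin_dim_def using basis_ijk basis_def
    by (intro exI[of _ "{i, j, k}"]) simp
  moreover have "dim = 3" using dim_basis[OF _ basis_ijk] distinct_ijk by simp
  ultimately show ?thesis by (simp add: three_dimensional_def vectorspace_axioms)
qed

lemma fin_dim: "fin_dim" and dim_3: "dim = 3"
  using three_dimensional by (simp_all add: three_dimensional_def)

text \<open>
  The basis \<open>i\<close>, \<open>j\<close>, \<open>k\<close> has determinant 1, and if it is a combination of \<open>a\<close>, \<open>b\<close>, \<open>c\<close>, this is a
  multiple of the determinant of \<open>a\<close>, \<open>b\<close>, \<open>c\<close>. Conversely, replacing one vector of a triple by a
  combination of all three multiplies the determinant by the coefficient of that vector; if the
  combination is zero and the determinant is not, the coefficient must vanish.
\<close>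

lemma ordered_basis_iff:
  "ordered_basis V bs \<longleftrightarrow>
    (\<exists>a b c. bs = [a, b, c] \<and> a \<in> carrier V \<and> b \<in> carrier V \<and> c \<in> carrier V \<and> trip a b c \<noteq> 0)"
proof
  assume bs: "ordered_basis V bs"
  have "length bs = card (set bs)" using bs by (simp add: ordered_basis_def distinct_card)
  also have "\<dots> = 3" using dim_basis[of "set bs"] bs dim_3 by (simp add: ordered_basis_def)
  finally obtain a b c where [simp]: "bs = [a, b, c]"
    by (auto simp: numeral_3_eq_3 length_Suc_conv)
  have abc: "a \<in> carrier V" "b \<in> carrier V" "c \<in> carrier V" "distinct [a, b, c]"
    and span: "span {a, b, c} = carrier V"
    using bs by (auto simp: ordered_basis_def basis_def)
  have "\<exists>x y z. v = x \<odot> a \<oplus> (y \<odot> b \<oplus> z \<odot> c)" if "v \<in> carrier V" for v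
    using that span span_3[OF abc] by blast
  then obtain x1 y1 z1 x2 y2 z2 x3 y3 z3 where
    ijk: "i = x1 \<odot> a \<oplus> (y1 \<odot> b \<oplus> z1 \<odot> c)" "j = x2 \<odot> a \<oplus> (y2 \<odot> b \<oplus> z2 \<odot> c)"
    "k = x3 \<odot> a \<oplus> (y3 \<odot> b \<oplus> z3 \<odot> c)"
    by (meson ijk_closed)
  let ?A = "mat 3 3 (\<lambda>(p, q). [[x1, y1, z1], [x2, y2, z2], [x3, y3, z3]] ! p ! q)"
  have "trip i j k = det ?A * trip a b c"
    using trip_linear_combination[OF abc(1-3), of ?A] by (simp add: ijk[symmetric])
  then have "trip a b c \<noteq> 0" by auto
  then show "\<exists>a b c. bs = [a, b, c] \<and> a \<in> carrier V \<and> b \<in> carrier V \<and> c \<in> carrier V \<and> trip a b c \<noteq> 0"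
    using abc by simp
next
  assume "\<exists>a b c. bs = [a, b, c] \<and> a \<in> carrier V \<and> b \<in> carrier V \<and> c \<in> carrier V \<and> trip a b c \<noteq> 0"
  then obtain a b c where bs: "bs = [a, b, c]" and abc: "a \<in> carrier V" "b \<in> carrier V" "c \<in> carrier V"
    and nz: "trip a b c \<noteq> 0" by blast
  have dist: "distinct [a, b, c]"
    using nz trip_alternating by auto
  have "lin_indpt {a, b, c}"
  proof (rule lin_indpt_3I[OF abc dist])
    fix x y z assume 0: "x \<odot> a \<oplus> (y \<odot> b \<oplus> z \<odot> c) = \<zero>" (is "?v = _")
    have "trip ?v b c = x * trip a b c" "trip a ?v c = y * trip a b c" "trip a b ?v = z * trip a b c"
      using abc by (simp_all add: trip_def algebra_simps)
    moreover have "trip \<zero> b c = 0" "trip a \<zero> c = 0" "trip a b \<zero> = 0"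
      by (simp_all add: trip_def)
    ultimately have "x * trip a b c = 0" "y * trip a b c = 0" "z * trip a b c = 0"
      by (simp_all only: 0)
    then show "x = 0 \<and> y = 0 \<and> z = 0" using nz by simp
  qed
  then have "basis {a, b, c}"
    using abc dist dim_3 by (intro dim_li_is_basis[OF fin_dim]) auto
  then show "ordered_basis V bs" using dist by (simp add: bs ordered_basis_def)
qed

text \<open>
  A change of basis with matrix \<open>A\<close> multiplies the determinant of coordinates by \<open>det A\<close>. So the sign
  of \<open>det A\<close> says whether the two determinants have the same sign.
\<close>

lemma same_orientation_iff:
  "([a, b, c], cs) \<in> same_orientation V \<longleftrightarrow>
    a \<in> carrier V \<and> b \<in> carrier V \<and> c \<in> carrier V \<and>
    (\<exists>a' b' c'. cs = [a', b', c'] \<and> a' \<in> carrier V \<and> b' \<in> carrier V \<and> c' \<in> carrier V \<and>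
      trip a b c * trip a' b' c' > 0)"
proof -
  have less_3: "{..<3::nat} = {0, 1, 2}" by auto
  have length_3: "length [a, b, c] = 3" by simp
  have det_pos_iff: "det A > 0 \<longleftrightarrow> trip a b c * trip a' b' c' > 0"
    if "trip a' b' c' = det A * trip a b c" "trip a b c \<noteq> 0" for A a' b' c'
  proof -
    have "trip a b c * trip a' b' c' = det A * (trip a b c)\<^sup>2"
      by (simp add: that(1) power2_eq_square)
    then show ?thesis using that(2) by (simp add: zero_less_mult_iff)
  qed
  show ?thesis
  proof
    assume "([a, b, c], cs) \<in> same_orientation V"
    then obtain A where bs: "ordered_basis V [a, b, c]" and cs: "ordered_basis V cs"
      and A: "A \<in> carrier_mat 3 3" and pos: "det A > 0"
      and eq: "\<And>p. p < 3 \<Longrightarrow> cs ! p = (\<Oplus>q \<in> {0, 1, 2}. (A $$ (p, q)) \<odot> ([a, b, c] ! q))"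
      unfolding same_orientation_def mem_Collect_eq prod.case length_3 less_3 by blast
    obtain a' b' c' where cs': "cs = [a', b', c']"
      and abc': "a' \<in> carrier V" "b' \<in> carrier V" "c' \<in> carrier V"
      using cs by (auto simp: ordered_basis_iff)
    have abc: "a \<in> carrier V" "b \<in> carrier V" "c \<in> carrier V" "trip a b c \<noteq> 0"
      using bs by (auto simp: ordered_basis_iff)
    have "cs ! p = A $$ (p, 0) \<odot> a \<oplus> (A $$ (p, 1) \<odot> b \<oplus> A $$ (p, 2) \<odot> c)" if "p < 3" for p
      using eq[OF that] abc by simp
    from this[of 0] this[of 1] this[of 2] have "trip a' b' c' = det A * trip a b c"
      using trip_linear_combination[OF abc(1-3) A] by (simp add: cs')
    then show "a \<in> carrier V \<and> b \<in> carrier V \<and> c \<in> carrier V \<and>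
      (\<exists>a' b' c'. cs = [a', b', c'] \<and> a' \<in> carrier V \<and> b' \<in> carrier V \<and> c' \<in> carrier V \<and>
        trip a b c * trip a' b' c' > 0)"
      using det_pos_iff[of a' b' c' A] pos abc abc' cs' by simp
  next
    assume "a \<in> carrier V \<and> b \<in> carrier V \<and> c \<in> carrier V \<and>
      (\<exists>a' b' c'. cs = [a', b', c'] \<and> a' \<in> carrier V \<and> b' \<in> carrier V \<and> c' \<in> carrier V \<and>
        trip a b c * trip a' b' c' > 0)"
    then obtain a' b' c' where abc: "a \<in> carrier V" "b \<in> carrier V" "c \<in> carrier V"
      and cs: "cs = [a', b', c']" and abc': "a' \<in> carrier V" "b' \<in> carrier V" "c' \<in> carrier V"
      and pos: "trip a b c * trip a' b' c' > 0" by blast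
    have nz: "trip a b c \<noteq> 0" "trip a' b' c' \<noteq> 0" using pos by auto
    have bases: "ordered_basis V [a, b, c]" "ordered_basis V cs"
      using abc abc' nz by (auto simp: ordered_basis_iff cs)
    then have dist: "distinct [a, b, c]" and span: "span {a, b, c} = carrier V"
      by (auto simp: ordered_basis_def basis_def)
    have "\<exists>x y z. v = x \<odot> a \<oplus> (y \<odot> b \<oplus> z \<odot> c)" if "v \<in> carrier V" for v
      using that span span_3[OF abc dist] by blast
    then obtain x1 y1 z1 x2 y2 z2 x3 y3 z3 where
      eq: "a' = x1 \<odot> a \<oplus> (y1 \<odot> b \<oplus> z1 \<odot> c)" "b' = x2 \<odot> a \<oplus> (y2 \<odot> b \<oplus> z2 \<odot> c)"
      "c' = x3 \<odot> a \<oplus> (y3 \<odot> b \<oplus> z3 \<odot> c)"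
      by (meson abc')
    define A where "A = mat 3 3 (\<lambda>(p, q). [[x1, y1, z1], [x2, y2, z2], [x3, y3, z3]] ! p ! q)"
    have A: "A \<in> carrier_mat 3 3" by (simp add: A_def)
    have "trip a' b' c' = det A * trip a b c"
      using trip_linear_combination[OF abc A] by (simp add: A_def eq[symmetric])
    then have "det A > 0" using det_pos_iff nz pos by blast
    moreover have "cs ! p = (\<Oplus>q \<in> {0, 1, 2}. (A $$ (p, q)) \<odot> ([a, b, c] ! q))" if "p < 3" for p
    proof -
      have "p = 0 \<or> p = 1 \<or> p = 2" using that by auto
      then show ?thesis using abc by (auto simp: A_def cs eq)
    qed
    ultimately show "([a, b, c], cs) \<in> same_orientation V"
      unfolding same_orientation_def mem_Collect_eq prod.case length_3 less_3 using bases A by blast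
  qed
qed

end

section \<open>Positively oriented orthonormal bases and the cross product\<close>

lemma (in inner_product_space) orthonormal_basis3I:
  assumes dim: "fin_dim" "dim = 3"
    and ijk: "i \<in> carrier V" "j \<in> carrier V" "k \<in> carrier V"
    and ip: "ip i i = 1" "ip j j = 1" "ip k k = 1" "ip j i = 0" "ip k i = 0" "ip k j = 0"
  shows "orthonormal_basis3 V i j k"
proof -
  note ip' = ip ip_sym[of i j] ip_sym[of i k] ip_sym[of j k]
  have dist: "distinct [i, j, k]"
    using ip by (metis distinct_length_2_or_more distinct_singleton zero_neq_one)
  have "lin_indpt {i, j, k}"
  proof (rule lin_indpt_3I[OF ijk dist])
    fix x y z assume "x \<odot> i \<oplus> (y \<odot> j \<oplus> z \<odot> k) = \<zero>" (is "?v = _")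
    then have "ip ?v i = 0" "ip ?v j = 0" "ip ?v k = 0" using ijk by (metis ip_zero(1))+
    then show "x = 0 \<and> y = 0 \<and> z = 0" using ijk ip' by simp
  qed
  then have "basis {i, j, k}"
    using ijk dist dim by (intro dim_li_is_basis) auto
  then have "span {i, j, k} = carrier V" by (simp add: basis_def)
  then show ?thesis
    using ijk ip' span_3[OF ijk dist] by unfold_locales auto
qed

lemma (in inner_product_space) exists_orthonormal_basis3:
  assumes dim: "fin_dim" "dim = 3"
  shows "\<exists>i j k. orthonormal_basis3 V i j k"
proof -
  obtain i where i: "i \<in> carrier V" "ip i i = 1"
    using exists_unit_orthogonal[of "{}"] dim by auto
  then obtain j where j: "j \<in> carrier V" "ip j j = 1" "ip j i = 0"
    using exists_unit_orthogonal[of "{i}"] dim by auto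
  then have ij: "i \<noteq> j" "ip i j = 0" using i ip_sym[of i j] by auto
  then obtain k where "k \<in> carrier V" "ip k k = 1" "ip k i = 0" "ip k j = 0"
    using exists_unit_orthogonal[of "{i, j}"] dim i j by force
  then show ?thesis using orthonormal_basis3I[of i j k] dim i j by blast
qed

text \<open>
  The orientation, given as an equivalence class of bases, becomes a sign condition on coordinates.
\<close>

locale oriented_frame = orthonormal_basis3 +
  assumes orientation_eq: "orientation V =
    {[a, b, c] | a b c. a \<in> carrier V \<and> b \<in> carrier V \<and> c \<in> carrier V \<and> trip a b c > 0}"

lemma (in orthonormal_basis3) same_orientation_Image:
  assumes "a \<in> carrier V" "b \<in> carrier V" "c \<in> carrier V" "trip a b c > 0"
  shows "same_orientation V `` {[a, b, c]} =
    {[a, b, c] | a b c. a \<in> carrier V \<and> b \<in> carrier V \<and> c \<in> carrier V \<and> trip a b c > 0}"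
  using assms by (auto simp: same_orientation_iff zero_less_mult_iff)

lemma oriented_frameI:
  assumes V: "oriented_space3 V" and ijk: "orthonormal_basis3 V i j k"
    and pos: "[i, j, k] \<in> orientation V"
  shows "oriented_frame V i j k"
proof -
  interpret orthonormal_basis3 V i j k by (rule ijk)
  obtain bs where bs: "ordered_basis V bs" "orientation V = same_orientation V `` {bs}"
    using V by (auto simp: oriented_space3_def elim!: quotientE)
  then obtain a b c where abc: "bs = [a, b, c]" "a \<in> carrier V" "b \<in> carrier V" "c \<in> carrier V"
    by (auto simp: ordered_basis_iff)
  have "trip a b c > 0" using pos by (simp add: bs abc same_orientation_iff)
  then show ?thesis using abc same_orientation_Image bs(2)
    by unfold_locales simp
qed

text \<open>
  If an orthonormal basis is negatively oriented, exchanging its first two vectors makes it positive.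
\<close>

lemma oriented_frame_exists:
  assumes V: "oriented_space3 V"
  shows "\<exists>i j k. oriented_frame V i j k"
proof -
  interpret inner_product_space V
    using V by (rule inner_product_space_of_oriented_space3)
  have dim: "fin_dim" "dim = 3"
    using V by (auto simp: oriented_space3_def three_dimensional_def)
  then obtain i j k where ijk: "orthonormal_basis3 V i j k"
    using exists_orthonormal_basis3 by blast
  then interpret orthonormal_basis3 V i j k .
  have jik: "orthonormal_basis3 V j i k"
    by (rule orthonormal_basis3I) (simp_all add: dim)
  obtain bs where bs: "ordered_basis V bs" "orientation V = same_orientation V `` {bs}"
    using V by (auto simp: oriented_space3_def elim!: quotientE)
  then obtain a b c where abc: "bs = [a, b, c]" "a \<in> carrier V" "b \<in> carrier V" "c \<in> carrier V"
      "trip a b c \<noteq> 0"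
    by (auto simp: ordered_basis_iff)
  then have "[i, j, k] \<in> orientation V \<or> [j, i, k] \<in> orientation V"
    by (auto simp: bs same_orientation_iff)
  then show ?thesis using oriented_frameI[OF V] ijk jik by blast
qed

context oriented_frame
begin

lemma orientation_iff:
  "[a, b, c] \<in> orientation V \<longleftrightarrow> a \<in> carrier V \<and> b \<in> carrier V \<and> c \<in> carrier V \<and> trip a b c > 0"
  by (auto simp: orientation_eq)

lemma oriented_space3: "oriented_space3 V"
proof -
  have "ordered_basis V [i, j, k]" by (simp add: ordered_basis_iff)
  moreover have "orientation V = same_orientation V `` {[i, j, k]}"
    using same_orientation_Image[of i j k] by (simp add: orientation_eq)
  ultimately show ?thesis
    using three_dimensional inner_product by (auto simp: oriented_space3_def quotient_def)
qed

text \<open>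
  For an orthonormal triple the square of the determinant is the Gram determinant, hence 1; so a
  positive determinant is 1, and the determinant is a volume form.
\<close>

lemma trip_orthonormal:
  assumes "bs \<in> orientation V" "orthonormal V bs"
  shows "trip (bs ! 0) (bs ! 1) (bs ! 2) = 1"
proof -
  obtain a b c where bs: "bs = [a, b, c]" and abc: "a \<in> carrier V" "b \<in> carrier V" "c \<in> carrier V"
    and pos: "trip a b c > 0"
    using assms(1) by (auto simp: orientation_eq)
  have on: "ip (bs ! p) (bs ! q) = (if p = q then 1 else 0)" if "p < 3" "q < 3" for p q
    using assms(2) that by (simp add: orthonormal_def bs)
  have gram: "ip a a = 1" "ip b b = 1" "ip c c = 1" "ip a b = 0" "ip a c = 0" "ip b c = 0"
    using on[of 0 0] on[of 1 1] on[of 2 2] on[of 0 1] on[of 0 2] on[of 1 2] by (simp_all add: bs)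
  have "(trip a b c)\<^sup>2 = ip a a * (ip b b * ip c c - ip b c * ip b c)
    - ip a b * (ip a b * ip c c - ip b c * ip a c) + ip a c * (ip a b * ip b c - ip b b * ip a c)"
    unfolding ip_coords[OF abc(1) abc(1)] ip_coords[OF abc(2) abc(2)] ip_coords[OF abc(3) abc(3)]
      ip_coords[OF abc(1) abc(2)] ip_coords[OF abc(1) abc(3)] ip_coords[OF abc(2) abc(3)]
    by (simp add: trip_def power2_eq_square algebra_simps)
  then have "trip a b c = 1" using pos by (simp add: gram power2_eq_1_iff)
  then show ?thesis by (simp add: bs)
qed

lemma trip_alternating_trilinear: "alternating_trilinear V trip"
  by (auto simp: alternating_trilinear_def bilinear_map_def linear_maps_iff trip_alternating)
    (simp_all add: trip_def algebra_simps)

text \<open>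
  Expanding all three arguments in the basis \<open>i\<close>, \<open>j\<close>, \<open>k\<close> leaves only the terms with distinct basis
  vectors, which are \<open>\<plusminus> \<omega> i j k\<close>.
\<close>

lemma alternating_trilinear_unique:
  assumes \<omega>: "alternating_trilinear V \<omega>"
    and abc: "a \<in> carrier V" "b \<in> carrier V" "c \<in> carrier V"
  shows "\<omega> a b c = trip a b c * \<omega> i j k"
proof -
  have lin: "\<omega> (u \<oplus> v) b c = \<omega> u b c + \<omega> v b c" "\<omega> b (u \<oplus> v) c = \<omega> b u c + \<omega> b v c"
    "\<omega> b c (u \<oplus> v) = \<omega> b c u + \<omega> b c v" 
    if "u \<in> carrier V" "v \<in> carrier V" "b \<in> carrier V" "c \<in> carrier V" for u v b c
    using \<omega> that by (simp_all add: alternating_trilinear_def bilinear_map_def linear_maps_iff)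
  have smult: "\<omega> (r \<odot> u) b c = r * \<omega> u b c" "\<omega> b (r \<odot> u) c = r * \<omega> b u c" "\<omega> b c (r \<odot> u) = r * \<omega> b c u"
    if "u \<in> carrier V" "b \<in> carrier V" "c \<in> carrier V" for u b c r
    using \<omega> that by (simp_all add: alternating_trilinear_def bilinear_map_def linear_maps_iff)
  have alt: "\<omega> u u v = 0" "\<omega> u v u = 0" "\<omega> v u u = 0" if "u \<in> carrier V" "v \<in> carrier V" for u v
    using \<omega> that by (simp_all add: alternating_trilinear_def)
  have swap12: "\<omega> v u w = - \<omega> u v w" if "u \<in> carrier V" "v \<in> carrier V" "w \<in> carrier V" for u v w
    using alt(1)[of "u \<oplus> v" w] alt(1)[of u w] alt(1)[of v w] that by (simp add: lin)
  have swap23: "\<omega> w v u = - \<omega> w u v" if "u \<in> carrier V" "v \<in> carrier V" "w \<in> carrier V" for u v w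
    using alt(3)[of "u \<oplus> v" w] alt(3)[of u w] alt(3)[of v w] that by (simp add: lin)
  have perms: "\<omega> j i k = - \<omega> i j k" "\<omega> i k j = - \<omega> i j k" "\<omega> j k i = \<omega> i j k"
    "\<omega> k i j = \<omega> i j k" "\<omega> k j i = - \<omega> i j k"
    using swap12[of i j k] swap23[of j k i] swap23[of i k j] swap12[of i k j] swap12[of j k i]
    by simp_all
  have "\<omega> a b c = \<omega> (vec (ip a i) (ip a j) (ip a k)) (vec (ip b i) (ip b j) (ip b k))
      (vec (ip c i) (ip c j) (ip c k))"
    using abc by simp
  also have "\<dots> = trip a b c * \<omega> i j k"
    by (simp only: vec_def) (simp add: lin smult alt perms trip_def algebra_simps)
  finally show ?thesis .
qed

lemma volume_form_eq_trip:
  assumes "a \<in> carrier V" "b \<in> carrier V" "c \<in> carrier V"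
  shows "volume_form V a b c = trip a b c"
proof -
  have "alternating_trilinear V (volume_form V) \<and>
    (\<forall>bs \<in> orientation V. orthonormal V bs \<longrightarrow> volume_form V (bs ! 0) (bs ! 1) (bs ! 2) = 1)"
    unfolding volume_form_def
    by (rule someI[of _ trip]) (use trip_alternating_trilinear trip_orthonormal in blast)
  moreover have "orthonormal V [i, j, k]"
    by (auto simp: orthonormal_def less_Suc_eq numeral_3_eq_3)
  ultimately show ?thesis
    using alternating_trilinear_unique[of "volume_form V" a b c] assms
    by (force simp: orientation_iff)
qed

text \<open>
  By nondegeneracy a vector is determined by its products with \<open>i\<close>, \<open>j\<close>, \<open>k\<close>, and these products are
  prescribed by the volume form.
\<close>

lemma cross_eq:
  assumes ab: "a \<in> carrier V" "b \<in> carrier V"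
  shows "cross V a b = vec (ip a j * ip b k - ip a k * ip b j)
    (ip a k * ip b i - ip a i * ip b k) (ip a i * ip b j - ip a j * ip b i)" (is "_ = ?v")
  unfolding cross_def
proof (rule the_equality, intro conjI ballI)
  fix c assume "c \<in> carrier V"
  then show "ip ?v c = volume_form V a b c"
    using ab by (simp add: volume_form_eq_trip ip_coords[of ?v c]) (simp add: trip_def algebra_simps)
next
  fix v assume v: "v \<in> carrier V \<and> (\<forall>c \<in> carrier V. ip v c = volume_form V a b c)"
  then show "v = ?v"
    using ab by (intro eq_by_coords) (simp_all add: volume_form_eq_trip trip_def)
qed simp

lemma cross_closed [simp]:
  "a \<in> carrier V \<Longrightarrow> b \<in> carrier V \<Longrightarrow> cross V a b \<in> carrier V"
  by (simp add: cross_eq)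

lemma cross_coords:
  assumes "a \<in> carrier V" "b \<in> carrier V"
  shows "ip (cross V a b) i = ip a j * ip b k - ip a k * ip b j"
    "ip (cross V a b) j = ip a k * ip b i - ip a i * ip b k"
    "ip (cross V a b) k = ip a i * ip b j - ip a j * ip b i"
  using assms by (simp_all add: cross_eq)

lemma volume_form_eq_ip_cross:
  assumes "a \<in> carrier V" "b \<in> carrier V" "c \<in> carrier V"
  shows "volume_form V a b c = ip (cross V a b) c"
  using assms by (simp add: volume_form_eq_trip ip_coords[of "cross V a b" c] cross_coords)
    (simp add: trip_def algebra_simps)

end

section \<open>The two categories\<close>

lemma compose_linear:
  assumes "f \<in> linear_maps U V" "g \<in> linear_maps V W" "vectorspace real_field U"
  shows "compose (carrier U) g f \<in> linear_maps U W"
proof -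
  interpret U: vectorspace real_field U by (rule assms)
  have "r \<odot>\<^bsub>U\<^esub> a \<in> carrier U" if "a \<in> carrier U" for r a using that U.smult_closed[of r a] by simp
  then show ?thesis
    using assms(1,2) by (auto simp: linear_maps_iff compose_def Pi_iff)
qed

lemma restrict_id_linear:
  assumes "vectorspace real_field V"
  shows "(\<lambda>a \<in> carrier V. a) \<in> linear_maps V V"
proof -
  interpret V: vectorspace real_field V by (rule assms)
  have "r \<odot>\<^bsub>V\<^esub> a \<in> carrier V" if "a \<in> carrier V" for r a using that V.smult_closed[of r a] by simp
  then show ?thesis by (auto simp: linear_maps_iff)
qed

lemma orientation_subset_carrier:
  assumes "oriented_space3 V" "bs \<in> orientation V"
  shows "set bs \<subseteq> carrier V"
proof -
  obtain i j k where "oriented_frame V i j k" using assms oriented_frame_exists by blast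
  then interpret oriented_frame V i j k .
  show ?thesis using assms by (auto simp: orientation_eq)
qed

lemma oriented_isometriesD:
  assumes "f \<in> oriented_isometries V W"
  shows "f \<in> extensional (carrier V)" "f \<in> linear_maps V W"
    "\<And>a. a \<in> carrier V \<Longrightarrow> f a \<in> carrier W"
    "\<And>a b. a \<in> carrier V \<Longrightarrow> b \<in> carrier V \<Longrightarrow> iprod W (f a) (f b) = iprod V a b"
    "\<And>bs. bs \<in> orientation V \<Longrightarrow> map f bs \<in> orientation W"
  using assms by (auto simp: oriented_isometries_def linear_maps_iff)

lemma category_oriented_spaces: "category oriented_spaces"
proof
  fix V :: "'a oriented_space" assume V: "V \<in> Ob oriented_spaces"
  then have V': "oriented_space3 V" by (simp add: oriented_spaces_def)
  have "map (\<lambda>a \<in> carrier V. a) bs = bs" if "bs \<in> orientation V" for bs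
    using orientation_subset_carrier[OF V' that] by (intro map_idI) auto
  then show "Id oriented_spaces V \<in> Hom oriented_spaces V V"
    using V' restrict_id_linear[of V]
    by (auto simp: oriented_spaces_def oriented_isometries_def oriented_space3_def three_dimensional_def)
next
  fix U V W :: "'a oriented_space" and f g
  assume U: "U \<in> Ob oriented_spaces" and f: "f \<in> Hom oriented_spaces U V"
    and g: "g \<in> Hom oriented_spaces V W"
  have U': "oriented_space3 U" using U by (simp add: oriented_spaces_def)
  have f': "f \<in> oriented_isometries U V" and g': "g \<in> oriented_isometries V W"
    using f g by (simp_all add: oriented_spaces_def)
  have "compose (carrier U) g f \<in> linear_maps U W"
    using f' g' U' compose_linear[of f U V g W]
    by (simp add: oriented_isometries_def oriented_space3_def three_dimensional_def)
  moreover have "map (compose (carrier U) g f) bs \<in> orientation W" if "bs \<in> orientation U" for bs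
  proof -
    have "map (compose (carrier U) g f) bs = map g (map f bs)"
      using orientation_subset_carrier[OF U' that] by (auto simp: compose_eq)
    then show ?thesis
      using oriented_isometriesD(5)[OF g' oriented_isometriesD(5)[OF f' that]] by (simp only:)
  qed
  ultimately have "compose (carrier U) g f \<in> oriented_isometries U W"
    using oriented_isometriesD(3,4)[OF f'] oriented_isometriesD(3,4)[OF g']
    unfolding oriented_isometries_def by (auto simp: compose_eq)
  then show "Comp oriented_spaces U V W g f \<in> Hom oriented_spaces U W"
    by (simp add: oriented_spaces_def)
qed (auto simp: oriented_spaces_def oriented_isometries_def linear_maps_iff compose_Id
    Id_compose Pi_iff intro!: compose_assoc[symmetric])

lemma real_algebraD:
  assumes "real_algebra A"
  shows "vectorspace real_field A" "\<one>\<^bsub>A\<^esub> \<in> carrier A"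
    "\<And>x y. x \<in> carrier A \<Longrightarrow> y \<in> carrier A \<Longrightarrow> x \<oplus>\<^bsub>A\<^esub> y \<in> carrier A"
    "\<And>r x. x \<in> carrier A \<Longrightarrow> r \<odot>\<^bsub>A\<^esub> x \<in> carrier A"
    "\<And>x y. x \<in> carrier A \<Longrightarrow> y \<in> carrier A \<Longrightarrow> x \<otimes>\<^bsub>A\<^esub> y \<in> carrier A"
proof -
  show vs: "vectorspace real_field A" and "\<one>\<^bsub>A\<^esub> \<in> carrier A"
    using assms by (simp_all add: real_algebra_def)
  interpret vectorspace real_field A by (rule vs)
  show "\<And>x y. x \<in> carrier A \<Longrightarrow> y \<in> carrier A \<Longrightarrow> x \<oplus>\<^bsub>A\<^esub> y \<in> carrier A" by simp
  show "\<And>r x. x \<in> carrier A \<Longrightarrow> r \<odot>\<^bsub>A\<^esub> x \<in> carrier A" using smult_closed by simp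
  show "\<And>x y. x \<in> carrier A \<Longrightarrow> y \<in> carrier A \<Longrightarrow> x \<otimes>\<^bsub>A\<^esub> y \<in> carrier A"
    using assms by (auto simp: real_algebra_def bilinear_map_def linear_maps_iff)
qed

lemma algebra_isosD:
  assumes "f \<in> algebra_isos A B"
  shows "f \<in> extensional (carrier A)" "f \<in> linear_maps A B" "bij_betw f (carrier A) (carrier B)"
    "f \<one>\<^bsub>A\<^esub> = \<one>\<^bsub>B\<^esub>" "\<And>x. x \<in> carrier A \<Longrightarrow> f x \<in> carrier B"
    "\<And>x y. x \<in> carrier A \<Longrightarrow> y \<in> carrier A \<Longrightarrow> f (x \<oplus>\<^bsub>A\<^esub> y) = f x \<oplus>\<^bsub>B\<^esub> f y"
    "\<And>r x. x \<in> carrier A \<Longrightarrow> f (r \<odot>\<^bsub>A\<^esub> x) = r \<odot>\<^bsub>B\<^esub> f x"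
    "\<And>x y. x \<in> carrier A \<Longrightarrow> y \<in> carrier A \<Longrightarrow> f (x \<otimes>\<^bsub>A\<^esub> y) = f x \<otimes>\<^bsub>B\<^esub> f y"
  using assms by (auto simp: algebra_isos_def linear_maps_iff)

lemma restrict_id_algebra_iso:
  assumes "real_algebra A"
  shows "(\<lambda>x \<in> carrier A. x) \<in> algebra_isos A A"
  using real_algebraD[OF assms] restrict_id_linear[of A]
  by (auto simp: algebra_isos_def bij_betw_def inj_on_def)

lemma compose_algebra_isos:
  assumes A: "real_algebra A" and f: "f \<in> algebra_isos A B" and g: "g \<in> algebra_isos B E"
  shows "compose (carrier A) g f \<in> algebra_isos A E"
proof -
  have "bij_betw (compose (carrier A) g f) (carrier A) (carrier E)"
    using algebra_isosD(3)[OF f] algebra_isosD(3)[OF g] by (rule bij_betw_compose)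
  then show ?thesis
    using real_algebraD[OF A] algebra_isosD[OF f] algebra_isosD[OF g] compose_linear[of f A B g E]
    by (auto simp: algebra_isos_def compose_eq)
qed

lemma inverse_algebra_iso:
  assumes A: "real_algebra A" and f: "f \<in> algebra_isos A B"
  defines "g \<equiv> \<lambda>y \<in> carrier B. inv_into (carrier A) f y"
  shows "g \<in> algebra_isos B A"
    "compose (carrier A) g f = (\<lambda>x \<in> carrier A. x)" "compose (carrier B) f g = (\<lambda>y \<in> carrier B. y)"
proof -
  note A' = real_algebraD[OF A] and f' = algebra_isosD[OF f]
  have gf: "g (f x) = x" if "x \<in> carrier A" for x
    using that f' by (simp add: g_def bij_betw_inv_into_left)
  have surj: "\<exists>x \<in> carrier A. y = f x" if "y \<in> carrier B" for y
    using that f'(3) by (auto simp: bij_betw_def)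
  have fB: "f x \<oplus>\<^bsub>B\<^esub> f y = f (x \<oplus>\<^bsub>A\<^esub> y)" "r \<odot>\<^bsub>B\<^esub> f x = f (r \<odot>\<^bsub>A\<^esub> x)" "f x \<otimes>\<^bsub>B\<^esub> f y = f (x \<otimes>\<^bsub>A\<^esub> y)"
    if "x \<in> carrier A" "y \<in> carrier A" for x y r
    using that f' by simp_all
  have "bij_betw (inv_into (carrier A) f) (carrier B) (carrier A)"
    using f'(3) by (rule bij_betw_inv_into)
  then have "bij_betw g (carrier B) (carrier A)"
    by (rule bij_betw_cong[THEN iffD1, rotated]) (simp add: g_def)
  moreover have "g \<one>\<^bsub>B\<^esub> = \<one>\<^bsub>A\<^esub>" using gf[of "\<one>\<^bsub>A\<^esub>"] A' f' by simp
  moreover have "g \<in> linear_maps B A"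
    using A' by (auto simp: linear_maps_iff fB gf dest!: surj)
  moreover have "\<forall>x \<in> carrier B. \<forall>y \<in> carrier B. g (x \<otimes>\<^bsub>B\<^esub> y) = g x \<otimes>\<^bsub>A\<^esub> g y"
    using A' by (auto simp: fB gf dest!: surj)
  moreover have "g \<in> extensional (carrier B)" by (simp add: g_def)
  ultimately show "g \<in> algebra_isos B A" by (simp add: algebra_isos_def)
  show "compose (carrier A) g f = (\<lambda>x \<in> carrier A. x)"
    by (auto simp: compose_def gf)
  show "compose (carrier B) f g = (\<lambda>y \<in> carrier B. y)"
    by (auto simp: compose_def gf fun_eq_iff dest!: surj)
qed

lemma algebra_isos_funcset: "f \<in> algebra_isos A B \<Longrightarrow> f \<in> carrier A \<rightarrow> carrier B"
  by (auto dest: algebra_isosD)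

lemma category_quaternion_algebras: "category quaternion_algebras"
proof
  fix A B :: "(real, 'a) module" and f
  assume "f \<in> Hom quaternion_algebras A B"
  then have f: "f \<in> carrier A \<rightarrow> carrier B" "f \<in> extensional (carrier A)"
    by (auto simp: quaternion_algebras_def algebra_isos_funcset algebra_isosD(1))
  show "Comp quaternion_algebras A A B f (Id quaternion_algebras A) = f"
    "Comp quaternion_algebras A B B (Id quaternion_algebras B) f = f"
    using compose_Id[OF f] Id_compose[OF f] by (simp_all add: quaternion_algebras_def)
next
  fix A B E K :: "(real, 'a) module" and f g h
  assume "f \<in> Hom quaternion_algebras A B"
  then have "f \<in> carrier A \<rightarrow> carrier B"
    by (auto simp: quaternion_algebras_def algebra_isos_funcset)
  then show "Comp quaternion_algebras A B K (Comp quaternion_algebras B E K h g) f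
      = Comp quaternion_algebras A E K h (Comp quaternion_algebras A B E g f)"
    using compose_assoc[of f "carrier A" "carrier B" h g]
    by (simp add: quaternion_algebras_def)
qed (simp_all add: quaternion_algebras_def restrict_id_algebra_iso compose_algebra_isos)

text \<open>
  An algebra isomorphism is by definition a bijective homomorphism; its set-theoretic inverse is again
  a homomorphism, so it is an isomorphism in the categorical sense.
\<close>

lemma quaternion_algebras_iso:
  assumes "real_algebra A" "f \<in> algebra_isos A B"
  shows "cat_iso quaternion_algebras A B f"
  unfolding cat_iso_def
  using assms inverse_algebra_iso[OF assms] by (auto simp: quaternion_algebras_def)

section \<open>The algebra of an oriented space\<close>

lemma H_ob_simps [simp]:
  "carrier (H_ob V) = UNIV \<times> carrier V"
  "x \<oplus>\<^bsub>H_ob V\<^esub> y = (fst x + fst y, snd x \<oplus>\<^bsub>V\<^esub> snd y)"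
  "r \<odot>\<^bsub>H_ob V\<^esub> x = (r * fst x, r \<odot>\<^bsub>V\<^esub> snd x)"
  "\<zero>\<^bsub>H_ob V\<^esub> = (0, \<zero>\<^bsub>V\<^esub>)" "\<one>\<^bsub>H_ob V\<^esub> = (1, \<zero>\<^bsub>V\<^esub>)"
  "(\<alpha>, a) \<otimes>\<^bsub>H_ob V\<^esub> (\<beta>, b) =
    (\<alpha> * \<beta> - iprod V a b, (\<alpha> \<odot>\<^bsub>V\<^esub> b) \<oplus>\<^bsub>V\<^esub> (\<beta> \<odot>\<^bsub>V\<^esub> a) \<oplus>\<^bsub>V\<^esub> cross V a b)"
  by (simp_all add: H_ob_def direct_sum_def)

lemma vectorspace_real_line: "vectorspace real_field real_line"
  by (rule vs_criteria) 
    (auto simp: algebra_simps class_field.field_axioms intro: exI[of _ "- x" for x])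

lemma vectorspace_H_ob:
  assumes "vectorspace real_field V"
  shows "vectorspace real_field (H_ob V)"
proof -
  have "vectorspace real_field (direct_sum real_line V)"
    using vectorspace_real_line assms by (rule direct_sum_is_vs)
  moreover have "add_monoid (H_ob V) = add_monoid (direct_sum real_line V)"
    by (simp add: H_ob_def direct_sum_def)
  ultimately show ?thesis
    unfolding vectorspace_def Module.module_def Module.module_axioms_def abelian_group_def abelian_monoid_def
      abelian_group_axioms_def
    by (simp add: direct_sum_def)
qed

context oriented_frame
begin

definition quaternion_coords :: "real \<times> 'a \<Rightarrow> real \<times> real \<times> real \<times> real" where
  "quaternion_coords = (\<lambda>x \<in> UNIV \<times> carrier V. (fst x, ip (snd x) i, ip (snd x) j, ip (snd x) k))"

text \<open>
  In the coordinates of a positive orthonormal basis the product of \<open>H(V)\<close> is, term by term,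
  Hamilton's multiplication table.
\<close>

lemma quaternion_coords_iso: "quaternion_coords \<in> algebra_isos (H_ob V) quaternions"
proof -
  have "bij_betw quaternion_coords (UNIV \<times> carrier V) UNIV"
  proof (rule bij_betw_byWitness[where f' = "\<lambda>(r, x, y, z). (r, vec x y z)"])
  qed (auto simp: quaternion_coords_def)
  moreover have "quaternion_coords (x \<otimes>\<^bsub>H_ob V\<^esub> y)
      = quaternion_coords x \<otimes>\<^bsub>quaternions\<^esub> quaternion_coords y"
    if "x \<in> UNIV \<times> carrier V" "y \<in> UNIV \<times> carrier V" for x y
  proof -
    obtain \<alpha> a \<beta> b where xy: "x = (\<alpha>, a)" "y = (\<beta>, b)" and ab: "a \<in> carrier V" "b \<in> carrier V"
      using \<open>x \<in> _\<close> \<open>y \<in> _\<close> by auto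
    show ?thesis
      using ab ip_coords[OF ab] by (simp add: xy quaternion_coords_def quaternions_def cross_coords)
  qed
  ultimately show ?thesis
    by (auto simp: algebra_isos_def linear_maps_iff) 
      (auto simp: quaternion_coords_def quaternions_def)
qed

text \<open>
  The cross product being given by coordinates, so is the product of \<open>H(V)\<close>; the algebra axioms are
  then polynomial identities.
\<close>

lemma bilinear_H_mult: "bilinear_map (H_ob V) (H_ob V) (H_ob V) (mult (H_ob V))"
  unfolding bilinear_map_def linear_maps_iff
  by (auto intro!: eq_by_coords simp: cross_coords algebra_simps)

lemma real_algebra_H_ob: "real_algebra (H_ob V)"
proof -
  have vs: "vectorspace real_field (H_ob V)" by (rule vectorspace_H_ob) (rule vectorspace_axioms)
  then interpret H: vectorspace real_field "H_ob V" .
  let ?S = "{(1, \<zero>), (0, i), (0, j), (0, k)}"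
  have S: "?S \<subseteq> carrier (H_ob V)" by simp
  interpret span: submodule real_field "H.span ?S" "H_ob V"
    using S by (rule H.span_is_submodule)
  have in_span: "r \<odot>\<^bsub>H_ob V\<^esub> x \<in> H.span ?S" if "x \<in> ?S" for r x
    using span.smult_closed[OF _ H.span_mem[OF S that], of r] by simp
  have "x \<in> H.span ?S" if "x \<in> carrier (H_ob V)" for x
  proof -
    obtain \<alpha> a where x: "x = (\<alpha>, a)" and a: "a \<in> carrier V" using \<open>x \<in> _\<close> by auto
    have "x = \<alpha> \<odot>\<^bsub>H_ob V\<^esub> (1, \<zero>) \<oplus>\<^bsub>H_ob V\<^esub> (ip a i \<odot>\<^bsub>H_ob V\<^esub> (0, i) \<oplus>\<^bsub>H_ob V\<^esub>
      (ip a j \<odot>\<^bsub>H_ob V\<^esub> (0, j) \<oplus>\<^bsub>H_ob V\<^esub> ip a k \<odot>\<^bsub>H_ob V\<^esub> (0, k)))"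
      using a by (auto simp: x intro!: eq_by_coords)
    moreover have "\<dots> \<in> H.span ?S"
      by (intro span.m_closed in_span) auto
    ultimately show ?thesis by simp
  qed
  then have "H.fin_dim"
    unfolding H.fin_dim_def using S H.span_is_subset2[OF S] by (intro exI[of _ ?S]) auto
  then show ?thesis
    using vs bilinear_H_mult by (auto simp: real_algebra_def cross_coords intro!: eq_by_coords)
qed

end

section \<open>The functor and its full faithfulness\<close>

text \<open>
  A linear isometry taking one positive orthonormal basis to a positive one takes coordinates to
  coordinates. Since product, cross product and orientation are expressed in coordinates, it preserves
  all of them, and it is bijective.
\<close>

lemma oriented_frame_map:
  assumes V: "oriented_frame V i j k" and W: "oriented_space3 W"
    and f: "f \<in> linear_maps V W"
    and ip: "\<And>a b. a \<in> carrier V \<Longrightarrow> b \<in> carrier V \<Longrightarrow> iprod W (f a) (f b) = iprod V a b"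
    and pos: "[f i, f j, f k] \<in> orientation W"
  shows "oriented_frame W (f i) (f j) (f k)"
proof -
  interpret V: oriented_frame V i j k by (rule V)
  interpret W: inner_product_space W using W by (rule inner_product_space_of_oriented_space3)
  have "orthonormal_basis3 W (f i) (f j) (f k)"
    using W f by (intro W.orthonormal_basis3I)
      (auto simp: ip oriented_space3_def three_dimensional_def linear_maps_iff)
  then show ?thesis using W pos by (intro oriented_frameI)
qed

lemma isometry_cross:
  assumes V: "oriented_frame V i j k" and W: "oriented_frame W (f i) (f j) (f k)"
    and f: "f \<in> linear_maps V W"
    and ip: "\<And>a b. a \<in> carrier V \<Longrightarrow> b \<in> carrier V \<Longrightarrow> iprod W (f a) (f b) = iprod V a b"
    and ab: "a \<in> carrier V" "b \<in> carrier V"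
  shows "f (cross V a b) = cross W (f a) (f b)"
proof -
  interpret V: oriented_frame V i j k by (rule V)
  interpret W: oriented_frame W "f i" "f j" "f k" by (rule W)
  have f': "\<And>c. c \<in> carrier V \<Longrightarrow> f c \<in> carrier W" using f by (auto simp: linear_maps_iff)
  show ?thesis
    using ab by (intro W.eq_by_coords) (simp_all add: f' ip W.cross_coords V.cross_coords)
qed

lemma isometry_bij:
  assumes V: "oriented_frame V i j k" and W: "oriented_frame W (f i) (f j) (f k)"
    and f: "f \<in> linear_maps V W"
    and ip: "\<And>a b. a \<in> carrier V \<Longrightarrow> b \<in> carrier V \<Longrightarrow> iprod W (f a) (f b) = iprod V a b"
  shows "bij_betw f (carrier V) (carrier W)"
proof -
  interpret V: oriented_frame V i j k by (rule V)
  interpret W: oriented_frame W "f i" "f j" "f k" by (rule W)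
  have f': "\<And>c. c \<in> carrier V \<Longrightarrow> f c \<in> carrier W" using f by (auto simp: linear_maps_iff)
  show ?thesis
  proof (rule bij_betw_byWitness)
    let ?g = "\<lambda>b. V.vec (iprod W b (f i)) (iprod W b (f j)) (iprod W b (f k))"
    show "\<forall>a \<in> carrier V. ?g (f a) = a" by (simp add: ip)
    have "f (?g b) = b" if b: "b \<in> carrier W" for b
    proof (rule W.eq_by_coords)
      have "iprod W (f (?g b)) (f c) = iprod V (?g b) c" if "c \<in> carrier V" for c
        using that by (simp add: ip)
      then show "iprod W (f (?g b)) (f i) = iprod W b (f i)"
        "iprod W (f (?g b)) (f j) = iprod W b (f j)" "iprod W (f (?g b)) (f k) = iprod W b (f k)"
        by simp_all
    qed (simp_all add: b f')
    then show "\<forall>b \<in> carrier W. f (?g b) = b" by blast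
  qed (auto simp: f')
qed

lemma on_ob_H: "on_ob H_functor V = H_ob V"
  by (simp add: H_functor_def)

lemma on_hom_H: "on_hom H_functor V W f = (\<lambda>x \<in> UNIV \<times> carrier V. (fst x, f (snd x)))"
  by (simp add: H_functor_def case_prod_beta')

lemma real_algebra_H: "oriented_space3 V \<Longrightarrow> real_algebra (H_ob V)"
  using oriented_frame_exists[of V] by (auto dest: oriented_frame.real_algebra_H_ob)

lemma H_isomorphic_quaternions: "oriented_space3 V \<Longrightarrow> \<exists>f. f \<in> algebra_isos (H_ob V) quaternions"
  using oriented_frame_exists[of V] by (auto dest: oriented_frame.quaternion_coords_iso)

lemma H_ob_in_quaternion_algebras: "oriented_space3 V \<Longrightarrow> H_ob V \<in> Ob quaternion_algebras"
  using real_algebra_H H_isomorphic_quaternions by (auto simp: quaternion_algebras_def)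

lemma H_hom_in_algebra_isos:
  assumes V: "oriented_space3 V" and W: "oriented_space3 W" and f: "f \<in> oriented_isometries V W"
  shows "on_hom H_functor V W f \<in> algebra_isos (H_ob V) (H_ob W)" (is "?h \<in> _")
proof -
  note f' = oriented_isometriesD[OF f]
  obtain i j k where ijk: "oriented_frame V i j k" using V oriented_frame_exists by blast
  then interpret V: oriented_frame V i j k .
  have pos: "[f i, f j, f k] \<in> orientation W" using f'(5)[of "[i, j, k]"] by (simp add: V.orientation_iff)
  have fijk: "oriented_frame W (f i) (f j) (f k)"
    using oriented_frame_map[OF ijk W f'(2) f'(4) pos] .
  interpret W: oriented_frame W "f i" "f j" "f k" by (rule fijk)
  note cross = isometry_cross[OF ijk fijk f'(2) f'(4)]
  have bij: "bij_betw f (carrier V) (carrier W)"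
    using isometry_bij[OF ijk fijk f'(2) f'(4)] .
  have lin: "f (a \<oplus>\<^bsub>V\<^esub> b) = f a \<oplus>\<^bsub>W\<^esub> f b" "f (r \<odot>\<^bsub>V\<^esub> a) = r \<odot>\<^bsub>W\<^esub> f a"
    if "a \<in> carrier V" "b \<in> carrier V" for a b r
    using f'(2) that by (simp_all add: linear_maps_iff)
  have zero: "f \<zero>\<^bsub>V\<^esub> = \<zero>\<^bsub>W\<^esub>"
    by (rule W.eq_by_coords) (simp_all add: f')
  have "bij_betw (map_prod id f) (UNIV \<times> carrier V) (UNIV \<times> carrier W)"
    using bij by (intro bij_betw_map_prod) simp_all
  then have "bij_betw ?h (UNIV \<times> carrier V) (UNIV \<times> carrier W)"
    by (rule bij_betw_cong[THEN iffD1, rotated]) (auto simp: on_hom_H)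
  then show ?thesis
    by (auto simp: algebra_isos_def linear_maps_iff) (auto simp: on_hom_H f' lin cross zero)
qed

lemma H_functor:
  "cat_functor (oriented_spaces :: ('v oriented_space, 'v \<Rightarrow> 'v) cat) quaternion_algebras H_functor"
proof (intro cat_functor.intro cat_functor_axioms.intro category_oriented_spaces
    category_quaternion_algebras)
  fix V :: "'v oriented_space" assume "V \<in> Ob oriented_spaces"
  then show "on_ob H_functor V \<in> Ob quaternion_algebras"
    using H_ob_in_quaternion_algebras by (simp add: on_ob_H oriented_spaces_def)
  show "on_hom H_functor V V (Id oriented_spaces V)
      = Id quaternion_algebras (on_ob H_functor V)"
    by (auto simp: on_hom_H on_ob_H oriented_spaces_def quaternion_algebras_def)
next
  fix V W :: "'v oriented_space" and f
  assume "V \<in> Ob oriented_spaces" "W \<in> Ob oriented_spaces" "f \<in> Hom oriented_spaces V W"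
  then show "on_hom H_functor V W f \<in> Hom quaternion_algebras (on_ob H_functor V) (on_ob H_functor W)"
    using H_hom_in_algebra_isos
    by (simp add: on_ob_H oriented_spaces_def quaternion_algebras_def)
next
  fix U V W :: "'v oriented_space" and f g
  assume "f \<in> Hom oriented_spaces U V" "g \<in> Hom oriented_spaces V W"
  then show "on_hom H_functor U W (Comp oriented_spaces U V W g f)
    = Comp quaternion_algebras (on_ob H_functor U) (on_ob H_functor V) (on_ob H_functor W)
        (on_hom H_functor V W g) (on_hom H_functor U V f)"
    by (auto simp: on_hom_H on_ob_H oriented_spaces_def quaternion_algebras_def fun_eq_iff
      compose_def oriented_isometriesD)
qed

lemma H_faithful:
  assumes f: "f \<in> oriented_isometries V W" and g: "g \<in> oriented_isometries V W"
    and eq: "on_hom H_functor V W f = on_hom H_functor V W g"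
  shows "f = g"
proof (rule extensionalityI[of _ "carrier V"])
  fix a assume "a \<in> carrier V"
  then show "f a = g a" using fun_cong[OF eq, of "(0, a)"] by (simp add: on_hom_H)
qed (use f g in \<open>simp_all add: oriented_isometriesD\<close>)

text \<open>
  The square of an imaginary element is a nonpositive real, which forces its image to be imaginary
  too. So an isomorphism is \<open>id \<oplus> f\<close>. Since \<open>(0, a) (0, b) = (- a \<cdot> b, a \<times> b)\<close>, the map \<open>f\<close>
  preserves both products, and hence the volume form and the orientation.
\<close>

lemma H_full:
  assumes V: "oriented_space3 V" and W: "oriented_space3 W"
    and h: "h \<in> algebra_isos (H_ob V) (H_ob W)"
  shows "\<exists>f \<in> oriented_isometries V W. on_hom H_functor V W f = h"
proof -
  note h' = algebra_isosD[OF h]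
  obtain i j k where ijk: "oriented_frame V i j k" using V oriented_frame_exists by blast
  then interpret V: oriented_frame V i j k .
  obtain p q r where pqr: "oriented_frame W p q r" using W oriented_frame_exists by blast
  then interpret W: oriented_frame W p q r .
  have V_cross_self: "cross V a a = \<zero>\<^bsub>V\<^esub>" if "a \<in> carrier V" for a
    using that by (intro V.eq_by_coords) (simp_all add: V.cross_coords)
  have W_cross_self: "cross W a a = \<zero>\<^bsub>W\<^esub>" if "a \<in> carrier W" for a
    using that by (intro W.eq_by_coords) (simp_all add: W.cross_coords)
  have V_imag_mult: "(0, a) \<otimes>\<^bsub>H_ob V\<^esub> (0, b) = (- iprod V a b, cross V a b)"
    if "a \<in> carrier V" "b \<in> carrier V" for a b
    using that by (auto intro!: V.eq_by_coords)
  have W_imag_mult: "(0, a) \<otimes>\<^bsub>H_ob W\<^esub> (0, b) = (- iprod W a b, cross W a b)"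
    if "a \<in> carrier W" "b \<in> carrier W" for a b
    using that by (auto intro!: W.eq_by_coords)
  have h_real: "h (x, \<zero>\<^bsub>V\<^esub>) = (x, \<zero>\<^bsub>W\<^esub>)" for x
    using h'(7)[of "(1, \<zero>\<^bsub>V\<^esub>)" x] h'(4) V.rmult_0[of x] W.rmult_0[of x] by simp
  define f where "f = (\<lambda>a \<in> carrier V. snd (h (0, a)))"
  have ext: "f \<in> extensional (carrier V)" by (simp add: f_def)
  have f_closed: "f a \<in> carrier W" if "a \<in> carrier V" for a
    using h'(5)[of "(0, a)"] that by (auto simp: f_def)
  have h_imag: "h (0, a) = (0, f a)" if a: "a \<in> carrier V" for a
  proof -
    obtain \<beta> b where hb: "h (0, a) = (\<beta>, b)" and b: "b \<in> carrier W"
      using h'(5)[of "(0, a)"] a by auto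
    have "(\<beta>, b) \<otimes>\<^bsub>H_ob W\<^esub> (\<beta>, b) = h (- iprod V a a, \<zero>\<^bsub>V\<^esub>)"
      using h'(8)[of "(0, a)" "(0, a)"] a by (simp only: hb V_imag_mult V_cross_self) simp
    then have sq: "\<beta> * \<beta> - iprod W b b = - iprod V a a"
      and "(\<beta> \<odot>\<^bsub>W\<^esub> b) \<oplus>\<^bsub>W\<^esub> (\<beta> \<odot>\<^bsub>W\<^esub> b) \<oplus>\<^bsub>W\<^esub> cross W b b = \<zero>\<^bsub>W\<^esub>"
      by (simp_all add: h_real)
    from arg_cong[OF this(2), of "\<lambda>c. iprod W c b"] have "\<beta> * iprod W b b = 0"
      using b by (simp add: W_cross_self)
    moreover have "iprod V a a \<ge> 0" using V.ip_coords[OF a a] by simp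
    \<comment> \<open>If \<open>b = 0\<close>, then \<open>\<beta> * \<beta> = - (a \<cdot> a)\<close> is both nonnegative and nonpositive.\<close>
    ultimately have "\<beta> = 0"
      using sq zero_le_square[of \<beta>] by (cases "\<beta> = 0") simp_all
    then show ?thesis using a hb by (simp add: f_def)
  qed
  have h_eq: "h (x, a) = (x, f a)" if a: "a \<in> carrier V" for x a
    using h'(6)[of "(x, \<zero>\<^bsub>V\<^esub>)" "(0, a)"] a by (simp add: h_real h_imag f_closed)
  have prods: "iprod W (f a) (f b) = iprod V a b" "f (cross V a b) = cross W (f a) (f b)"
    if ab: "a \<in> carrier V" "b \<in> carrier V" for a b
  proof -
    have "h (- iprod V a b, cross V a b) = (0, f a) \<otimes>\<^bsub>H_ob W\<^esub> (0, f b)"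
      using h'(8)[of "(0, a)" "(0, b)"] ab by (simp only: h_imag V_imag_mult) simp
    then show "iprod W (f a) (f b) = iprod V a b" "f (cross V a b) = cross W (f a) (f b)"
      using ab by (simp_all only: h_eq W_imag_mult f_closed V.cross_closed) simp_all
  qed
  have lin: "f \<in> linear_maps V W"
    unfolding linear_maps_iff
  proof (intro conjI ballI allI)
    fix a b assume ab: "a \<in> carrier V" "b \<in> carrier V"
    then show "f (a \<oplus>\<^bsub>V\<^esub> b) = f a \<oplus>\<^bsub>W\<^esub> f b"
      using h'(6)[of "(0, a)" "(0, b)"] by (simp add: h_imag)
  next
    fix r a assume a: "a \<in> carrier V"
    then show "f (r \<odot>\<^bsub>V\<^esub> a) = r \<odot>\<^bsub>W\<^esub> f a"
      using h'(7)[of "(0, a)" r] by (simp add: h_imag)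
  qed (simp add: f_closed)
  \<comment> \<open>Preserving both products, \<open>f\<close> preserves the sign of one positive basis, hence of all.\<close>
  have "cross V i j = k"
    by (rule V.eq_by_coords) (simp_all add: V.cross_coords)
  then have "volume_form W (f i) (f j) (f k) = 1"
    using prods(1)[of k k] prods(2)[of i j] by (simp add: W.volume_form_eq_ip_cross f_closed)
  then have "[f i, f j, f k] \<in> orientation W"
    by (simp add: W.orientation_iff f_closed W.volume_form_eq_trip)
  then have "oriented_frame W (f i) (f j) (f k)"
    using oriented_frame_map[OF ijk W lin prods(1)] by blast
  then interpret fW: oriented_frame W "f i" "f j" "f k" .
  have "map f bs \<in> orientation W" if "bs \<in> orientation V" for bs
    using that
    by (auto simp: V.orientation_eq fW.orientation_iff f_closed V.trip_def fW.trip_def prods)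
  then have "f \<in> oriented_isometries V W"
    using lin prods ext by (simp add: oriented_isometries_def)
  moreover have "on_hom H_functor V W f = h"
    by (rule extensionalityI[of _ "UNIV \<times> carrier V"]) 
      (use h'(1) h_eq in \<open>auto simp: on_hom_H\<close>)
  ultimately show ?thesis by blast
qed

section \<open>Essential surjectivity\<close>

text \<open>
  The standard oriented space \<open>\<real>\<^sup>3\<close>, transported along an injection \<open>u\<close> into an arbitrary type;
  \<open>B\<close> is the set of lists declared to be its positive bases. It is a parameter because the right
  choice is defined by means of coordinates in the space itself.
\<close>

definition coordinate_space ::
  "(real \<times> real \<times> real \<Rightarrow> 'v) \<Rightarrow> 'v list set \<Rightarrow> 'v oriented_space" where
  "coordinate_space u B =
    \<lparr>carrier = range u, mult = (\<lambda>_ _. u (0, 0, 0)), one = u (0, 0, 0), zero = u (0, 0, 0),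
     add = (\<lambda>a b. case (inv_into UNIV u a, inv_into UNIV u b) of
       ((x, y, z), (x', y', z')) \<Rightarrow> u (x + x', y + y', z + z')),
     smult = (\<lambda>r a. case inv_into UNIV u a of (x, y, z) \<Rightarrow> u (r * x, r * y, r * z)),
     iprod = (\<lambda>a b. case (inv_into UNIV u a, inv_into UNIV u b) of
       ((x, y, z), (x', y', z')) \<Rightarrow> x * x' + y * y' + z * z'),
     orientation = B\<rparr>"

lemma orthonormal_basis3_coordinate_space:
  assumes u: "inj u"
  shows "orthonormal_basis3 (coordinate_space u B) (u (1, 0, 0)) (u (0, 1, 0)) (u (0, 0, 1))"
proof -
  let ?V = "coordinate_space u B"
  have "vectorspace real_field ?V"
  proof (rule vs_criteria)
    show "field real_field" by (rule class_field.field_axioms)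
    show "\<forall>v \<in> carrier ?V. \<exists>w \<in> carrier ?V. v \<oplus>\<^bsub>?V\<^esub> w = \<zero>\<^bsub>?V\<^esub>"
    proof
      fix v assume "v \<in> carrier ?V"
      then obtain x y z where "v = u (x, y, z)" by (auto simp: coordinate_space_def)
      then show "\<exists>w \<in> carrier ?V. v \<oplus>\<^bsub>?V\<^esub> w = \<zero>\<^bsub>?V\<^esub>"
        using u by (intro bexI[of _ "u (- x, - y, - z)"]) (simp_all add: coordinate_space_def)
    qed
  qed (use u in \<open>auto simp: coordinate_space_def algebra_simps\<close>)
  moreover have "inner_product ?V"
  proof -
    have "x * x + (y * y + z * z) > 0" if "u (x, y, z) \<noteq> u (0, 0, 0)" for x y z
    proof -
      have "x \<noteq> 0 \<or> y \<noteq> 0 \<or> z \<noteq> 0" using that by auto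
      then have "x * x > 0 \<or> y * y > 0 \<or> z * z > 0" by (auto simp: zero_less_mult_iff)
      then show ?thesis using zero_le_square[of x] zero_le_square[of y] zero_le_square[of z] by linarith
    qed
    then show ?thesis
      using u by (auto simp: inner_product_def bilinear_map_def linear_maps_iff
        coordinate_space_def algebra_simps)
  qed
  ultimately have "inner_product_space ?V"
    by (simp add: inner_product_space_def inner_product_space_axioms_def)
  then interpret inner_product_space ?V .
  show ?thesis
    by unfold_locales (use u in \<open>auto simp: coordinate_space_def\<close>)
qed

lemma exists_oriented_frame_of_inj:
  fixes u :: "real \<times> real \<times> real \<Rightarrow> 'v"
  assumes u: "inj u"
  shows "\<exists>(V :: 'v oriented_space) i j k. oriented_frame V i j k"
proof -
  let ?i = "u (1, 0, 0)" and ?j = "u (0, 1, 0)" and ?k = "u (0, 0, 1)"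
  let ?V0 = "coordinate_space u {}"
  interpret V0: orthonormal_basis3 ?V0 ?i ?j ?k
    using u by (rule orthonormal_basis3_coordinate_space)
  define B where "B = {[a, b, c] | a b c.
    a \<in> carrier ?V0 \<and> b \<in> carrier ?V0 \<and> c \<in> carrier ?V0 \<and> V0.trip a b c > 0}"
  define V where "V = coordinate_space u B"
  interpret V: orthonormal_basis3 V ?i ?j ?k
    unfolding V_def using u by (rule orthonormal_basis3_coordinate_space)
  have V: "iprod V = iprod ?V0" "carrier V = carrier ?V0" "orientation V = B"
    by (simp_all add: V_def coordinate_space_def)
  have "V.trip = V0.trip"
    by (simp add: fun_eq_iff V.trip_def V0.trip_def V)
  then have "orientation V = {[a, b, c] | a b c.
      a \<in> carrier V \<and> b \<in> carrier V \<and> c \<in> carrier V \<and> V.trip a b c > 0}"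
    by (simp add: V B_def)
  then have "oriented_frame V ?i ?j ?k" by unfold_locales
  then show ?thesis by blast
qed

text \<open>An infinite set is equipotent with its square, so \<open>\<real>\<^sup>3\<close> fits wherever \<open>\<real>\<close> does.\<close>

lemma exists_inj_real_triples:
  assumes "\<exists>e :: real \<Rightarrow> 'v. inj e"
  shows "\<exists>u :: real \<times> real \<times> real \<Rightarrow> 'v. inj u"
proof -
  obtain e :: "real \<Rightarrow> 'v" where e: "inj e" using assms by blast
  have "infinite (UNIV :: real set)" by (rule infinite_UNIV_char_0)
  then obtain p :: "real \<times> real \<Rightarrow> real" where "bij_betw p (UNIV \<times> UNIV) UNIV"
    using card_of_Times_same_infinite card_of_ordIso by blast
  then have "inj p" by (simp add: bij_betw_def)
  then have "inj (\<lambda>(x, y, z). e (p (x, p (y, z))))"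
    by (intro injI) (auto simp: inj_eq[OF e] inj_eq[OF \<open>inj p\<close>])
  then show ?thesis by blast
qed

theorem theorem2:
  assumes "\<exists>e :: real \<Rightarrow> 'v. inj e"
  shows "cat_functor (oriented_spaces :: ('v oriented_space, 'v \<Rightarrow> 'v) cat) quaternion_algebras H_functor \<and>
    cat_equivalence (oriented_spaces :: ('v oriented_space, 'v \<Rightarrow> 'v) cat) quaternion_algebras H_functor"
proof
  let ?C = "oriented_spaces :: ('v oriented_space, 'v \<Rightarrow> 'v) cat"
  show "cat_functor ?C quaternion_algebras H_functor" by (rule H_functor)
  then show "cat_equivalence ?C quaternion_algebras H_functor"
  proof (rule cat_equivalenceI)
    fix V W :: "'v oriented_space" and h
    assume "V \<in> Ob ?C" "W \<in> Ob ?C"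
      "h \<in> Hom quaternion_algebras (on_ob H_functor V) (on_ob H_functor W)"
    then show "\<exists>f \<in> Hom ?C V W. on_hom H_functor V W f = h"
      using H_full by (simp add: oriented_spaces_def quaternion_algebras_def on_ob_H)
  next
    fix V W :: "'v oriented_space" and f g
    assume "f \<in> Hom ?C V W" "g \<in> Hom ?C V W" "on_hom H_functor V W f = on_hom H_functor V W g"
    then show "f = g" using H_faithful by (simp add: oriented_spaces_def)
  next
    fix A :: "(real, real \<times> 'v) module" assume "A \<in> Ob quaternion_algebras"
    then obtain f where A: "real_algebra A" and f: "f \<in> algebra_isos A quaternions"
      by (auto simp: quaternion_algebras_def)
    \<comment> \<open>All objects of the target are isomorphic to one another, so one oriented space suffices.\<close>
    obtain u :: "real \<times> real \<times> real \<Rightarrow> 'v" where "inj u"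
      using exists_inj_real_triples[OF assms] by blast
    then obtain V :: "'v oriented_space" and i j k where "oriented_frame V i j k"
      using exists_oriented_frame_of_inj by blast
    then have V: "oriented_space3 V" by (rule oriented_frame.oriented_space3)
    then obtain g where "g \<in> algebra_isos (H_ob V) quaternions"
      using H_isomorphic_quaternions by blast
    then obtain g' where "g' \<in> algebra_isos quaternions (H_ob V)"
      using inverse_algebra_iso(1) real_algebra_H[OF V] by blast
    then have "compose (carrier A) g' f \<in> algebra_isos A (H_ob V)"
      using compose_algebra_isos A f by blast
    then obtain h where "h \<in> algebra_isos (H_ob V) A"
      using inverse_algebra_iso(1) A by blast
    then have "cat_iso quaternion_algebras (on_ob H_functor V) A h"
      using quaternion_algebras_iso[OF real_algebra_H[OF V]] by (simp add: on_ob_H)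
    then show "\<exists>V \<in> Ob ?C. \<exists>h. cat_iso quaternion_algebras (on_ob H_functor V) A h"
      using V by (auto simp: oriented_spaces_def)
  qed
qed

end
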